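(* Let $n\ge 4$ be an integer, and let $G$ be the graph constructed as follows. Take three pairwise disjoint paths $P_i=x^i_1\ldots x^i_{2n}$, $i=0,1,2$, and another path $Q=y_1\ldots y_{4n}$ disjoint from each $P_i$. For all $i\in\{0,1,2\}$, $j\in\{1,\dots,2n\}$, $k\in\{1,\dots,4n\}$ add a new path $P^i_{j,k}$ between $x^i_j$ and $y_k$, of length $n$ if $k=n+j$ and of length $5n$ otherwise, where all these paths are internally disjoint from one another and all their internal vertices are new. Take the disjoint union of the resulting graph with a cycle $C$ of length $16n+2$, choose two vertices $a,b$ of $C$ with $d_C(a,b)=8n+1$, and add the four edges $ax^0_1$, $ay_1$, $bx^0_{2n}$ and $by_{4n}$. Then the connected order of every bramble of $G$ is at most $5n+3$, while the connected tree-width of $G$ is at least $6n$. In particular, the connected tree-width of $G$ is larger than the connected order of any bramble of $G$.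
   Context: Graphs are finite, simple and undirected; the length of a path or cycle is its number of edges, and $d_C$ denotes distance in $C$. A tree-decomposition of $G$ is a pair $(T,(V_t)_{t\in T})$ of a tree $T$ and vertex sets (parts) $V_t\subseteq V(G)$, one for each node $t$ of $T$, such that: $V(G)=\bigcup_{t}V_t$; every edge of $G$ has both ends in some $V_t$; and $V_{t_1}\cap V_{t_3}\subseteq V_{t_2}$ whenever $t_2$ lies on the path in $T$ from $t_1$ to $t_3$. Its width is $\max_t(|V_t|-1)$. A vertex set $X\subseteq V(G)$ is connected if $G[X]$ is connected; connected sets are non-empty. A tree-decomposition is connected if each of its parts is connected in $G$, and the connected tree-width of $G$ is the minimum width of a connected tree-decomposition of $G$. A bramble of $G$ is a collection of connected vertex sets of $G$ such that the union of any two of them is again connected. A cover of a bramble is a set of vertices that meets every element of the bramble. The connected order of a bramble is the minimum size of a connected cover of it. *)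

theory Defs
  imports "Graph_Theory.Graph_Theory" "HOL-Library.Extended_Nat"
begin

text \<open>
  A finite simple undirected graph is a \<^locale>\<open>pair_graph\<close>: a finite, symmetric, loop-free
  digraph whose arcs are ordered pairs, so an edge \<open>uv\<close> is the pair of arcs \<open>(u, v)\<close>, \<open>(v, u)\<close>.
\<close>

section \<open>Connected tree-width and brambles\<close>

text \<open>
  \<^const>\<open>connected\<close> (of digraphs) requires a non-empty vertex set.
\<close>

definition connected_set :: "'a pair_pre_digraph \<Rightarrow> 'a set \<Rightarrow> bool" where
  "connected_set G X \<longleftrightarrow> X \<subseteq> pverts G \<and> Digraph_Component.connected (with_proj G \<restriction> X)"

text \<open>
  The library's \<^const>\<open>tree\<close> forbids directed cycles only, so that in a symmetric digraph every
  edge would count as a cycle of length 2.  The undirected cycles are those of length at least 3.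
\<close>

definition undirected_tree :: "'t pair_pre_digraph \<Rightarrow> bool" where
  "undirected_tree T \<longleftrightarrow> pair_graph T \<and> Digraph_Component.connected (with_proj T) \<and>
     \<not> (\<exists>c. pre_digraph.cycle (with_proj T) c \<and> 3 \<le> length c)"

definition tree_decomposition ::
    "'a pair_pre_digraph \<Rightarrow> 't pair_pre_digraph \<Rightarrow> ('t \<Rightarrow> 'a set) \<Rightarrow> bool" where
  "tree_decomposition G T V \<longleftrightarrow>
     undirected_tree T \<and>
     (\<Union>t\<in>pverts T. V t) = pverts G \<and>
     (\<forall>(u, v)\<in>parcs G. \<exists>t\<in>pverts T. u \<in> V t \<and> v \<in> V t) \<and>
     (\<forall>t1 p t3. pre_digraph.apath (with_proj T) t1 p t3 \<longrightarrow>
        (\<forall>t2\<in>set (pre_digraph.awalk_verts (with_proj T) t1 p). V t1 \<inter> V t3 \<subseteq> V t2))"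

text \<open>
  The subtraction is on \<^typ>\<open>nat\<close>; it is exact for non-empty parts, in particular for
  connected tree-decompositions.
\<close>

definition width :: "'t pair_pre_digraph \<Rightarrow> ('t \<Rightarrow> 'a set) \<Rightarrow> nat" where
  "width T V = Max ((\<lambda>t. card (V t) - 1) ` pverts T)"

definition connected_tree_decomposition ::
    "'a pair_pre_digraph \<Rightarrow> 't pair_pre_digraph \<Rightarrow> ('t \<Rightarrow> 'a set) \<Rightarrow> bool" where
  "connected_tree_decomposition G T V \<longleftrightarrow>
     tree_decomposition G T V \<and> (\<forall>t\<in>pverts T. connected_set G (V t))"

text \<open>
  Minima are infima in \<^typ>\<open>enat\<close>: attained whenever there is a candidate (as there is for every
  connected graph), and \<open>\<infinity>\<close> otherwise.  Decomposition trees are finite, so taking their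
  nodes to be natural numbers is no restriction.
\<close>

definition connected_tree_width :: "'a pair_pre_digraph \<Rightarrow> enat" where
  "connected_tree_width G =
     (INF (T, V)\<in>{(T :: nat pair_pre_digraph, V). connected_tree_decomposition G T V}.
        enat (width T V))"

definition bramble :: "'a pair_pre_digraph \<Rightarrow> 'a set set \<Rightarrow> bool" where
  "bramble G B \<longleftrightarrow> (\<forall>X\<in>B. connected_set G X) \<and> (\<forall>X\<in>B. \<forall>Y\<in>B. connected_set G (X \<union> Y))"

definition bramble_cover :: "'a pair_pre_digraph \<Rightarrow> 'a set set \<Rightarrow> 'a set \<Rightarrow> bool" where
  "bramble_cover G B S \<longleftrightarrow> S \<subseteq> pverts G \<and> (\<forall>X\<in>B. S \<inter> X \<noteq> {})"

definition connected_order :: "'a pair_pre_digraph \<Rightarrow> 'a set set \<Rightarrow> enat" where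
  "connected_order G B = (INF S\<in>{S. bramble_cover G B S \<and> connected_set G S}. enat (card S))"

section \<open>The graph\<close>

text \<open>
  \<open>Px i j\<close> is $x^i_j$, \<open>Qy k\<close> is $y_k$, \<open>Link i j k l\<close> is the inner vertex of $P^i_{j,k}$ at
  distance \<open>l\<close> along it from $x^i_j$, and \<open>Cyc m\<close> are the vertices of $C$ in cyclic order.
\<close>

datatype vertex = Px nat nat | Qy nat | Link nat nat nat nat | Cyc nat

definition undirected :: "'a set \<Rightarrow> 'a rel \<Rightarrow> 'a pair_pre_digraph" where
  "undirected V E = mk_symmetric (with_proj \<lparr>pverts = V, parcs = E\<rparr>)"

definition P_path :: "nat \<Rightarrow> nat \<Rightarrow> vertex list" where
  "P_path n i = map (Px i) [1..<2 * n + 1]"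

definition Q_path :: "nat \<Rightarrow> vertex list" where
  "Q_path n = map Qy [1..<4 * n + 1]"

definition link_length :: "nat \<Rightarrow> nat \<Rightarrow> nat \<Rightarrow> nat" where
  "link_length n j k = (if k = n + j then n else 5 * n)"

definition link_path :: "nat \<Rightarrow> nat \<Rightarrow> nat \<Rightarrow> nat \<Rightarrow> vertex list" where
  "link_path n i j k = Px i j # map (Link i j k) [1..<link_length n j k] @ [Qy k]"

definition all_paths :: "nat \<Rightarrow> vertex list set" where
  "all_paths n =
     P_path n ` {0, 1, 2} \<union> {Q_path n} \<union>
     {link_path n i j k | i j k. i \<in> {0, 1, 2} \<and> j \<in> {1..2 * n} \<and> k \<in> {1..4 * n}}"

definition cycle_list :: "nat \<Rightarrow> vertex list" where
  "cycle_list n = map Cyc [0..<16 * n + 2]"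

definition C_graph :: "nat \<Rightarrow> vertex pair_pre_digraph" where
  "C_graph n =
     undirected (set (cycle_list n)) (set (vwalk_arcs (cycle_list n @ [hd (cycle_list n)])))"

definition gap_graph :: "nat \<Rightarrow> vertex \<Rightarrow> vertex \<Rightarrow> vertex pair_pre_digraph" where
  "gap_graph n a b =
     undirected
       ((\<Union>p\<in>all_paths n. set p) \<union> pverts (C_graph n))
       ((\<Union>p\<in>all_paths n. set (vwalk_arcs p)) \<union> parcs (C_graph n) \<union>
        {(a, Px 0 1), (a, Qy 1), (b, Px 0 (2 * n)), (b, Qy (4 * n))})"

text \<open>Distance, i.e. the library's weighted distance with unit weights.\<close>

definition graph_dist :: "'a pair_pre_digraph \<Rightarrow> 'a \<Rightarrow> 'a \<Rightarrow> ereal" where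
  "graph_dist G u v = wf_digraph.\<mu> (with_proj G) (\<lambda>_. 1) u v"

end

theory Submission
  imports Defs
begin

text \<open>
  Upper bound.  If a bramble has an element inside a link, then this link is a cover.  If it has a short
  element inside one of the two arcs of $C$ between $a$ and $b$, then this element and its two neighbours on
  $C$ are a cover.  If there are elements inside an arc and they are all long, then $P_0$ with $a$, $b$ and a
  piece of the arc is a cover.  Otherwise $aQb$ misses only elements that meet a common $P_i$ in pairwise touching intervals, and adding an edge
  of $P_i$ and a short link gives a cover.

  Lower bound.  Suppose that all parts are connected and have at most \<open>6 * n\<close> vertices.  As long as such a
  set $S$ does not contain $Q$, all vertices of the $P_i$ and of $Q$ outside $S$ lie in one component of
  $G - S$, and any two such components meet; hence some part contains $Q$.  Similarly some part contains $P_0$: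
  a connected set that contains $a$ and $b$ but neither all of $P_0$ nor an arc of $C$ has at least \<open>4 * n\<close>
  vertices outside $C$, hence at most \<open>2 * n\<close> on $C$, and so the large pieces of $C - S$ always meet.  No
  part contains both $Q$ and $P_0$.  On the way in the tree from the parts containing $Q$ to one containing $P_0$,
  the last part containing $Q$ is followed by one containing $P_0$, because the component above always lies on
  the side of $Q$.  The intersection of these two adjacent parts separates the rest of $P_0$ from the rest of $Q$,
  hence meets too many links.
\<close>

section \<open>Connected sets\<close>

text \<open>Walks of \<open>rtrancl_on X\<close> stay in \<open>X\<close> by definition, so arcs
  leaving \<open>X\<close> need not be removed from the relation; symmetry makes the symmetric
  closure in \<open>connected_conv\<close> harmless.\<close>

lemma connected_set_iff:
  assumes "sym (parcs G)"
  shows "connected_set G X \<longleftrightarrow> X \<subseteq> pverts G \<and> X \<noteq> {} \<and>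
    (\<forall>u\<in>X. \<forall>v\<in>X. (u, v) \<in> rtrancl_on X (parcs G))"
proof -
  have "arcs_ends (with_proj G \<restriction> X) = {(u, v) \<in> parcs G. u \<in> X \<and> v \<in> X}"
    by (auto simp: arcs_ends_conv)
  then have "((arcs_ends (with_proj G \<restriction> X))\<^sup>s) = {(u, v) \<in> parcs G. u \<in> X \<and> v \<in> X}"
    using assms by (auto simp: symcl_def sym_def)
  moreover have "(u, v) \<in> rtrancl_on X {(u, v) \<in> parcs G. u \<in> X \<and> v \<in> X} \<longleftrightarrow>
      (u, v) \<in> rtrancl_on X (parcs G)" for u v
  proof
    assume "(u, v) \<in> rtrancl_on X {(u, v) \<in> parcs G. u \<in> X \<and> v \<in> X}"
    then show "(u, v) \<in> rtrancl_on X (parcs G)"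
      by (induction rule: rtrancl_on_induct) (auto intro: rtrancl_on_into_rtrancl_on)
  next
    assume "(u, v) \<in> rtrancl_on X (parcs G)"
    then show "(u, v) \<in> rtrancl_on X {(u, v) \<in> parcs G. u \<in> X \<and> v \<in> X}"
      by (induction rule: rtrancl_on_induct) (auto intro: rtrancl_on_into_rtrancl_on)
  qed
  ultimately show ?thesis
    unfolding connected_set_def connected_conv by auto
qed

text \<open>The form in which connectedness is mostly used: to trap \<open>X\<close> in
  \<open>A\<close>, it suffices to check the edges inside \<open>X\<close> that start in
  \<open>A\<close>.\<close>

lemma connected_set_subsetI:
  assumes "sym (parcs G)" "connected_set G X" "u \<in> X" "u \<in> A"
    and closed: "\<And>v w. v \<in> X \<Longrightarrow> v \<in> A \<Longrightarrow> w \<in> X \<Longrightarrow> (v, w) \<in> parcs G \<Longrightarrow> w \<in> A"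
  shows "X \<subseteq> A"
proof
  fix x assume "x \<in> X"
  then have "(u, x) \<in> rtrancl_on X (parcs G)"
    using assms(2,3) connected_set_iff[OF assms(1)] by blast
  then show "x \<in> A"
  proof (induction rule: rtrancl_on_induct)
    case base
    show ?case by (rule assms(4))
  next
    case (step y z)
    then show ?case using closed by blast
  qed
qed

lemma connected_set_subset: "connected_set G X \<Longrightarrow> X \<subseteq> pverts G"
  by (simp add: connected_set_def)

lemma connected_set_nonempty: "sym (parcs G) \<Longrightarrow> connected_set G X \<Longrightarrow> X \<noteq> {}"
  by (simp add: connected_set_iff)

lemma connected_set_singleton: "sym (parcs G) \<Longrightarrow> v \<in> pverts G \<Longrightarrow> connected_set G {v}"
  by (simp add: connected_set_iff)

lemma connected_set_Union:
  assumes "sym (parcs G)" "F \<noteq> {}" "\<And>K. K \<in> F \<Longrightarrow> connected_set G K" "\<And>K. K \<in> F \<Longrightarrow> z \<in> K"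
  shows "connected_set G (\<Union>F)"
proof -
  have "(u, v) \<in> rtrancl_on (\<Union>F) (parcs G)" if uv: "u \<in> K" "K \<in> F" "v \<in> L" "L \<in> F" for u v K L
  proof -
    have "(u, z) \<in> rtrancl_on K (parcs G)" "(z, v) \<in> rtrancl_on L (parcs G)"
      using assms(3,4) uv connected_set_iff[OF assms(1)] by blast+
    then have "(u, z) \<in> rtrancl_on (\<Union>F) (parcs G)" "(z, v) \<in> rtrancl_on (\<Union>F) (parcs G)"
      using rtrancl_on_mono[OF order_refl Union_upper[OF uv(2)]]
        rtrancl_on_mono[OF order_refl Union_upper[OF uv(4)]] by blast+
    then show ?thesis by (rule rtrancl_on_trans)
  qed
  moreover have "\<Union>F \<subseteq> pverts G" "\<Union>F \<noteq> {}"
    using assms connected_set_subset by blast+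
  ultimately show ?thesis
    using assms(1) by (auto simp: connected_set_iff)
qed

lemma connected_set_Un:
  assumes "sym (parcs G)" "connected_set G X" "connected_set G Y" "z \<in> X" "z \<in> Y"
  shows "connected_set G (X \<union> Y)"
  using connected_set_Union[of G "{X, Y}" z] assms by auto

lemma connected_set_edge:
  assumes "sym (parcs G)" "(u, v) \<in> parcs G" "u \<in> pverts G" "v \<in> pverts G"
  shows "connected_set G {u, v}"
proof -
  have "(v, u) \<in> parcs G" using assms by (auto simp: sym_def)
  then have "(u, v) \<in> rtrancl_on {u, v} (parcs G)" "(v, u) \<in> rtrancl_on {u, v} (parcs G)"
    using assms by (auto intro: rtrancl_on_into_rtrancl_on[OF rtrancl_on_refl])
  then show ?thesis
    using assms by (auto simp: connected_set_iff)
qed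

lemma connected_set_insert:
  assumes "sym (parcs G)" "connected_set G X" "u \<in> X" "(u, v) \<in> parcs G" "v \<in> pverts G"
  shows "connected_set G (insert v X)"
proof -
  have "connected_set G (X \<union> {u, v})"
    using assms connected_set_subset by (intro connected_set_Un[of _ _ _ u] connected_set_edge) auto
  then show ?thesis
    using assms(3) by (simp add: insert_absorb)
qed

lemma connected_set_path:
  fixes f :: "nat \<Rightarrow> 'a"
  assumes "sym (parcs G)" "i \<le> j" "f ` {i..j} \<subseteq> pverts G"
    and "\<And>k. i \<le> k \<Longrightarrow> k < j \<Longrightarrow> (f k, f (Suc k)) \<in> parcs G"
  shows "connected_set G (f ` {i..j})"
  using assms(2-)
proof (induction j rule: dec_induct)
  case base
  then show ?case using assms(1) by (auto intro: connected_set_singleton)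
next
  case (step j)
  have "connected_set G (f ` {i..j})" by (rule step.IH) (use step in auto)
  then have "connected_set G (insert (f (Suc j)) (f ` {i..j}))"
    by (rule connected_set_insert[OF assms(1), of _ "f j"]) (use step in auto)
  then show ?case
    using step.hyps by (simp add: atLeastAtMostSuc_conv)
qed

text \<open>The component of \<open>G - S\<close> that contains \<open>v\<close>, empty if
  \<open>v\<close> lies in \<open>S\<close>. As a union of connected sets it needs just one
  connected witness for membership.\<close>

definition component_avoiding :: "'a pair_pre_digraph \<Rightarrow> 'a set \<Rightarrow> 'a \<Rightarrow> 'a set" where
  "component_avoiding G S v = \<Union>{K. connected_set G K \<and> K \<inter> S = {} \<and> v \<in> K}"

lemma component_avoidingI:
  "connected_set G K \<Longrightarrow> K \<inter> S = {} \<Longrightarrow> v \<in> K \<Longrightarrow> w \<in> K \<Longrightarrow> w \<in> component_avoiding G S v"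
  by (auto simp: component_avoiding_def)

lemma connected_component_avoiding:
  assumes "sym (parcs G)" "v \<in> pverts G" "v \<notin> S"
  shows "connected_set G (component_avoiding G S v)"
  unfolding component_avoiding_def
  by (rule connected_set_Union[OF assms(1), of _ v])
    (use assms in \<open>auto intro!: exI[of _ "{v}"] connected_set_singleton\<close>)

lemma component_avoiding_disjoint: "component_avoiding G S v \<inter> S = {}"
  by (auto simp: component_avoiding_def)

lemma component_avoiding_trans:
  assumes "sym (parcs G)" "v \<in> component_avoiding G S u" "w \<in> component_avoiding G S v"
  shows "w \<in> component_avoiding G S u"
proof -
  obtain K L where "connected_set G K" "K \<inter> S = {}" "u \<in> K" "v \<in> K"
    and "connected_set G L" "L \<inter> S = {}" "v \<in> L" "w \<in> L"
    using assms(2,3) unfolding component_avoiding_def by auto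
  then show ?thesis
    by (intro component_avoidingI[OF connected_set_Un[OF assms(1), of K L v]]) auto
qed

lemma component_avoiding_sym:
  "v \<in> component_avoiding G S u \<Longrightarrow> u \<in> component_avoiding G S v"
  by (auto simp: component_avoiding_def)

section \<open>Tree-decompositions\<close>

text \<open>The component of \<open>T - t\<close> that contains the neighbour \<open>t'\<close> of \<open>t\<close>.\<close>

definition branch :: "'t pair_pre_digraph \<Rightarrow> 't \<Rightarrow> 't \<Rightarrow> 't set" where
  "branch T t t' = {s. (t', s) \<in> rtrancl_on (pverts T - {t}) (parcs T)}"

text \<open>Shortening a walk to a path only drops vertices, so the path stays in \<open>F\<close>.
  This links \<open>rtrancl_on\<close> to the paths that occur in
  \<open>tree_decomposition\<close>.\<close>

lemma (in pair_wf_digraph) apath_in_set_if_rtrancl_on: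
  assumes "(u, v) \<in> rtrancl_on F (parcs G)" "F \<subseteq> pverts G"
  obtains p where "apath u p v" "set (pawalk_verts u p) \<subseteq> F"
proof -
  have "\<exists>p. awalk u p v \<and> set (pawalk_verts u p) \<subseteq> F"
    using assms(1)
  proof (induction rule: converse_rtrancl_on_induct)
    case base
    then show ?case using assms(2) by (intro exI[of _ "[]"]) (auto simp: awalk_Nil_iff)
  next
    case (step x y)
    then obtain p where "awalk y p v" "set (pawalk_verts y p) \<subseteq> F" by blast
    with step show ?case
      by (intro exI[of _ "(x, y) # p"]) (auto simp: awalk_Cons_iff)
  qed
  then obtain p where p: "awalk u p v" "set (pawalk_verts u p) \<subseteq> F" by blast
  let ?q = "awalk_to_apath p"
  have q: "apath u ?q v" by (rule apath_awalk_to_apath[OF p(1)])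
  have "set ?q \<subseteq> set p" by (rule awalk_to_apath_subset[OF p(1)])
  then have "set (pawalk_verts u ?q) \<subseteq> set (pawalk_verts u p)"
    using set_awalk_verts[OF p(1)] set_awalk_verts[OF awalkI_apath[OF q]] by auto
  with p(2) q that show thesis by blast
qed

section \<open>Branches of a finite tree\<close>

locale finite_tree =
  fixes T :: "'t pair_pre_digraph"
  assumes undirected_tree: "undirected_tree T"
begin

sublocale pair_graph T
  using undirected_tree by (simp add: undirected_tree_def)

lemma sym_arcs_T: "sym (parcs T)"
  using arcs_symmetric by (auto simp: sym_def)

lemma head_in_branch: "(t, t') \<in> parcs T \<Longrightarrow> t' \<in> branch T t t'"
  using no_loops' wellformed' by (auto simp: branch_def)

lemma branch_subset: "branch T t t' \<subseteq> pverts T - {t}"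
  unfolding branch_def using in_rtrancl_on_in_F by fastforce

lemma branch_step: "u \<in> branch T t t' \<Longrightarrow> (u, v) \<in> parcs T \<Longrightarrow> v \<noteq> t \<Longrightarrow> v \<in> branch T t t'"
  unfolding branch_def using wellformed' by (auto intro: rtrancl_on_into_rtrancl_on)

text \<open>A second way back to \<open>t\<close> would close a cycle of length at least 3 with a
  path inside the branch; this is where acyclicity enters.\<close>

lemma branch_boundary:
  assumes tt': "(t, t') \<in> parcs T" and u: "u \<in> branch T t t'" and uv: "(u, v) \<in> parcs T"
    and v: "v \<notin> branch T t t'"
  shows "u = t' \<and> v = t"
proof -
  have [simp]: "v = t" using branch_step[OF u uv] v by blast
  have "u = t'"
  proof (rule ccontr)
    assume "u \<noteq> t'"
    obtain p where p: "apath t' p u" "set (pawalk_verts t' p) \<subseteq> pverts T - {t}"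
      using apath_in_set_if_rtrancl_on[of t' u "pverts T - {t}"] u by (auto simp: branch_def)
    then have walk: "awalk t' p u" by (simp add: apath_def)
    have "p \<noteq> []" using walk \<open>u \<noteq> t'\<close> by (auto simp: awalk_Nil_iff)
    let ?c = "(t, t') # p @ [(u, t)]"
    have walk': "awalk t' (p @ [(u, t)]) t"
      using walk uv wellformed' by (auto simp: awalk_simps)
    then have "awalk t ?c t"
      using tt' by (auto simp: awalk_simps)
    moreover have "pawalk_verts t ?c = t # pawalk_verts t' p @ [t]"
      using walk awalk_verts_append[OF walk'] by auto
    then have "distinct (tl (pawalk_verts t ?c))"
      using p by (auto simp: apath_def)
    ultimately have "cycle ?c" unfolding cycle_def by blast
    moreover have "3 \<le> length ?c" using \<open>p \<noteq> []\<close> by (cases p) auto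
    ultimately show False using undirected_tree unfolding undirected_tree_def by blast
  qed
  then show ?thesis by simp
qed

lemma reachable_T: "s \<in> pverts T \<Longrightarrow> t \<in> pverts T \<Longrightarrow> (s, t) \<in> rtrancl_on (pverts T) (parcs T)"
proof -
  have "(parcs T)\<^sup>s = parcs T" using sym_arcs_T by (auto simp: symcl_def sym_def)
  then show "s \<in> pverts T \<Longrightarrow> t \<in> pverts T \<Longrightarrow> (s, t) \<in> rtrancl_on (pverts T) (parcs T)"
    using undirected_tree unfolding undirected_tree_def connected_conv by simp
qed

lemma ex_branch:
  assumes "s \<in> pverts T" "t \<in> pverts T" "s \<noteq> t"
  obtains t' where "(t, t') \<in> parcs T" "s \<in> branch T t t'"
proof -
  obtain p where p: "apath t p s"
    using apath_in_set_if_rtrancl_on[OF reachable_T[of t s]] assms by blast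
  with \<open>s \<noteq> t\<close> obtain e q where [simp]: "p = e # q"
    by (cases p) (auto simp: apath_Nil_iff)
  from p have e: "e \<in> parcs T" "fst e = t" and q: "apath (snd e) q s"
    "t \<notin> set (pawalk_verts (snd e) q)"
    by (auto simp: apath_Cons_iff)
  have "(u, v) \<in> rtrancl_on (pverts T - {t}) (parcs T)"
    if "awalk u r v" "t \<notin> set (pawalk_verts u r)" for u r v
    using that
  proof (induction r arbitrary: u)
    case Nil
    then show ?case by (auto simp: awalk_Nil_iff)
  next
    case (Cons e r)
    then show ?case
      using wellformed' by (cases e) (auto simp: awalk_Cons_iff intro: converse_rtrancl_on_into_rtrancl_on)
  qed
  then have "s \<in> branch T t (snd e)"
    using q by (auto simp: branch_def apath_def)
  then show thesis using that[of "snd e"] e by (cases e) auto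
qed

text \<open>The branches nest because the outer one can only be left along the edge from
  \<open>t'\<close> to \<open>t\<close>; \<open>t'\<close> witnesses strictness. Branch sizes thus
  serve as a descent measure.\<close>

lemma branch_psubset:
  assumes "(t, t') \<in> parcs T" "(t', t'') \<in> parcs T" "t'' \<noteq> t"
  shows "branch T t' t'' \<subset> branch T t t'"
proof -
  have t'': "t'' \<in> branch T t t'"
    using branch_step[OF head_in_branch] assms by blast
  have "s \<in> branch T t t'" if "(t'', s) \<in> rtrancl_on (pverts T - {t'}) (parcs T)" for s
    using that
  proof (induction rule: rtrancl_on_induct)
    case base
    show ?case by (rule t'')
  next
    case (step y z)
    then show ?case using branch_boundary[OF assms(1), of y z] by blast
  qed
  then have "branch T t' t'' \<subseteq> branch T t t'" by (auto simp: branch_def)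
  moreover have "t' \<in> branch T t t' - branch T t' t''"
    using head_in_branch assms(1) branch_subset by blast
  ultimately show ?thesis by blast
qed

text \<open>A walk that starts at \<open>t\<close> and avoids \<open>t'\<close> cannot enter the
  branch of \<open>t'\<close>, whose only edge to the outside ends in \<open>t'\<close>.\<close>

lemma opposite_branches_disjoint:
  assumes "(t, t') \<in> parcs T"
  shows "branch T t' t \<inter> branch T t t' = {}"
proof -
  have "s \<notin> branch T t t'" if "(t, s) \<in> rtrancl_on (pverts T - {t'}) (parcs T)" for s
    using that
  proof (induction rule: rtrancl_on_induct)
    case base
    then show ?case using branch_subset by blast
  next
    case (step y z)
    then show ?case using branch_boundary[OF assms, of z y] arcs_symmetric by blast
  qed
  then show ?thesis by (auto simp: branch_def)
qed

end

section \<open>Connected sets and the two sides of a tree edge\<close>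

locale tree_decomp = finite_tree T
  for T :: "'t pair_pre_digraph" +
  fixes G :: "'a pair_pre_digraph" and V :: "'t \<Rightarrow> 'a set"
  assumes decomposition: "tree_decomposition G T V"
    and sym_G: "sym (parcs G)"
begin

lemma in_some_part: "v \<in> pverts G \<Longrightarrow> \<exists>t\<in>pverts T. v \<in> V t"
  using decomposition unfolding tree_decomposition_def by blast

lemma edge_in_some_part: "(u, v) \<in> parcs G \<Longrightarrow> \<exists>t\<in>pverts T. u \<in> V t \<and> v \<in> V t"
  using decomposition unfolding tree_decomposition_def by blast

text \<open>The tree path from \<open>s\<close> to \<open>r\<close> leaves the branch and so passes
  through both \<open>t'\<close> and \<open>t\<close>; the third axiom of a tree-decomposition then
  applies to both.\<close>

lemma separation:
  assumes tt': "(t, t') \<in> parcs T" and s: "s \<in> branch T t t'" and r: "r \<in> pverts T" "r \<notin> branch T t t'"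
  shows "V s \<inter> V r \<subseteq> V t \<inter> V t'"
proof -
  have "s \<in> pverts T" using s branch_subset by blast
  then obtain p where p: "apath s p r"
    using apath_in_set_if_rtrancl_on[OF reachable_T[of s r]] r by blast
  have "t \<in> set (pawalk_verts u q) \<and> t' \<in> set (pawalk_verts u q)"
    if "awalk u q r" "u \<in> branch T t t'" for u q
    using that
  proof (induction q arbitrary: u)
    case Nil
    then show ?case using r by (auto simp: awalk_Nil_iff)
  next
    case (Cons e q)
    then have e: "e \<in> parcs T" "fst e = u" and q: "awalk (snd e) q r"
      by (auto simp: awalk_Cons_iff)
    show ?case
    proof (cases "snd e \<in> branch T t t'")
      case True
      then show ?thesis using Cons.IH[OF q] by auto
    next
      case False
      then have "u = t' \<and> snd e = t"
        using branch_boundary[OF tt' Cons.prems(2), of "snd e"] e by (cases e) auto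
      then show ?thesis
        using hd_in_awalk_verts(1)[OF q] e by auto
    qed
  qed
  then have "t \<in> set (pawalk_verts s p)" "t' \<in> set (pawalk_verts s p)"
    using p s by (auto simp: apath_def)
  moreover have "\<forall>t2\<in>set (pawalk_verts s p). V s \<inter> V r \<subseteq> V t2"
    using decomposition p unfolding tree_decomposition_def awalk_verts_with_proj_eq by simp
  ultimately show ?thesis by simp
qed

text \<open>Follow \<open>K\<close> edge by edge: each edge lies in some part, and if a part off the
  branch shared a vertex of \<open>K\<close> with a part on it, \<open>separation\<close> would put
  that vertex into \<open>V t \<inter> V t'\<close>.\<close>

lemma connected_in_branch:
  assumes tt': "(t, t') \<in> parcs T" and K: "connected_set G K" "K \<inter> (V t \<inter> V t') = {}"
    and v: "v \<in> K" "v \<in> V s" "s \<in> branch T t t'"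
    and w: "w \<in> K" "w \<in> V r" "r \<in> pverts T"
  shows "r \<in> branch T t t'"
proof -
  have "K \<subseteq> (\<Union>s\<in>branch T t t'. V s)"
  proof (rule connected_set_subsetI[OF sym_G K(1) v(1)])
    show "v \<in> (\<Union>s\<in>branch T t t'. V s)" using v by blast
  next
    fix x y assume xy: "x \<in> K" "x \<in> (\<Union>s\<in>branch T t t'. V s)" "y \<in> K" "(x, y) \<in> parcs G"
    obtain q where q: "q \<in> branch T t t'" "x \<in> V q" using xy(2) by blast
    obtain q' where q': "q' \<in> pverts T" "x \<in> V q'" "y \<in> V q'"
      using edge_in_some_part[OF xy(4)] by blast
    have "q' \<in> branch T t t'"
    proof (rule ccontr)
      assume "q' \<notin> branch T t t'"
      then have "x \<in> V t \<inter> V t'"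
        using separation[OF tt' q(1) q'(1)] q(2) q'(2) by blast
      then show False using xy(1) K(2) by blast
    qed
    then show "y \<in> (\<Union>s\<in>branch T t t'. V s)" using q' by blast
  qed
  then obtain q where q: "q \<in> branch T t t'" "w \<in> V q" using w(1) by blast
  show ?thesis
  proof (rule ccontr)
    assume "r \<notin> branch T t t'"
    then have "w \<in> V t \<inter> V t'"
      using separation[OF tt' q(1) w(3)] q(2) w(2) by blast
    then show False using w(1) K(2) by blast
  qed
qed

text \<open>
  Every node points to its neighbour in the direction of \<open>\<beta> t\<close>; some edge is then pointed at from both
  of its ends, and its two branches are disjoint.
\<close>

lemma no_haven:
  assumes conn: "\<And>t. t \<in> pverts T \<Longrightarrow> connected_set G (\<beta> t)"
    and disj: "\<And>t. t \<in> pverts T \<Longrightarrow> \<beta> t \<inter> V t = {}"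
    and meet: "\<And>t t'. t \<in> pverts T \<Longrightarrow> t' \<in> pverts T \<Longrightarrow> \<beta> t \<inter> \<beta> t' \<noteq> {}"
  shows False
proof -
  define R where "R t t' \<longleftrightarrow> (t, t') \<in> parcs T \<and>
    (\<forall>w\<in>\<beta> t. \<forall>r\<in>pverts T. w \<in> V r \<longrightarrow> r \<in> branch T t t')" for t t'
  have ex: "\<exists>t'. R t t'" if t: "t \<in> pverts T" for t
  proof -
    obtain v where v: "v \<in> \<beta> t" using connected_set_nonempty[OF sym_G conn[OF t]] by blast
    then obtain s where s: "s \<in> pverts T" "v \<in> V s"
      using in_some_part connected_set_subset[OF conn[OF t]] by blast
    then have "s \<noteq> t" using disj[OF t] v by blast
    then obtain t' where t': "(t, t') \<in> parcs T" "s \<in> branch T t t'"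
      using ex_branch[OF s(1) t] by blast
    \<comment> \<open>One vertex of \<open>\<beta> t\<close> fixes the direction; the rest follows
      since \<open>\<beta> t\<close> avoids \<open>V t\<close>, hence also
      \<open>V t \<inter> V t'\<close>.\<close>
    have "R t t'"
      unfolding R_def using connected_in_branch[OF t'(1) conn[OF t] _ v s(2) t'(2)] disj[OF t] t' by blast
    then show ?thesis ..
  qed
  obtain t0 where "t0 \<in> pverts T"
    using undirected_tree unfolding undirected_tree_def connected_conv by auto
  then obtain t1 where "R t0 t1" using ex by blast
  \<comment> \<open>Take a pointing edge with the smallest branch: if \<open>t'\<close> pointed away
    from \<open>t\<close>, the branch would shrink, so \<open>t'\<close> points back to
    \<open>t\<close>.\<close>
  then obtain p where "R (fst p) (snd p)"
    and "\<And>q. R (fst q) (snd q) \<Longrightarrow> card (branch T (fst p) (snd p)) \<le> card (branch T (fst q) (snd q))"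
    using ex_has_least_nat[of "\<lambda>p. R (fst p) (snd p)" "(t0, t1)"
      "\<lambda>p. card (branch T (fst p) (snd p))"] by auto
  then obtain t t' where tt': "R t t'"
    and min: "\<And>s s'. R s s' \<Longrightarrow> card (branch T t t') \<le> card (branch T s s')"
    by (metis fst_conv snd_conv)
  have arc: "(t, t') \<in> parcs T" using tt' by (simp add: R_def)
  then have verts: "t \<in> pverts T" "t' \<in> pverts T" using wellformed' by blast+
  obtain t'' where t'': "R t' t''" using ex verts by blast
  have "t'' = t"
  proof (rule ccontr)
    assume "t'' \<noteq> t"
    then have "branch T t' t'' \<subset> branch T t t'"
      using branch_psubset arc t'' by (simp add: R_def)
    moreover have "finite (branch T t t')"
      using finite_subset[OF branch_subset] pair_finite_verts by blast
    ultimately have "card (branch T t' t'') < card (branch T t t')"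
      by (intro psubset_card_mono)
    then show False using min[OF t''] by simp
  qed
  obtain v where v: "v \<in> \<beta> t" "v \<in> \<beta> t'" using meet[OF verts] by blast
  then obtain s where "s \<in> pverts T" "v \<in> V s"
    using in_some_part connected_set_subset[OF conn[OF verts(1)]] by blast
  then have "s \<in> branch T t t'" "s \<in> branch T t' t"
    using tt' t'' v unfolding R_def \<open>t'' = t\<close> by blast+
  then show False using opposite_branches_disjoint[OF arc] by blast
qed

end

section \<open>Adjacency in the graph\<close>

lemma set_vwalk_arcs_conv_nth:
  "set (vwalk_arcs p) = {(p ! i, p ! Suc i) | i. Suc i < length p}"
proof (induction p rule: vwalk_arcs.induct)
  case (3 x y xs)
  have "{((x # y # xs) ! i, (x # y # xs) ! Suc i) | i. Suc i < length (x # y # xs)} =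
      insert (x, y) {((y # xs) ! i, (y # xs) ! Suc i) | i. Suc i < length (y # xs)}"
    (is "?L = ?R")
  proof (intro equalityI subsetI)
    fix e assume "e \<in> ?L"
    then obtain i where "e = ((x # y # xs) ! i, (x # y # xs) ! Suc i)" "Suc i < length (x # y # xs)"
      by blast
    then show "e \<in> ?R" by (cases i) auto
  next
    fix e assume "e \<in> ?R"
    then consider "e = (x, y)" | i where "e = ((y # xs) ! i, (y # xs) ! Suc i)" "Suc i < length (y # xs)"
      by blast
    then show "e \<in> ?L"
    proof cases
      case 1 then show ?thesis by (auto intro!: exI[of _ 0])
    next
      case (2 i) then show ?thesis by (auto intro!: exI[of _ "Suc i"])
    qed
  qed
  then show ?case using 3 by simp
qed auto

lemma pverts_undirected [simp]: "pverts (undirected V E) = V"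
  by (simp add: undirected_def mk_symmetric_def)

lemma parcs_undirected: "parcs (undirected V E) = E \<union> E\<inverse>"
  by (auto simp: undirected_def mk_symmetric_def)

text \<open>
  The cycle is rotated: \<open>cyc m\<close> is the vertex at distance \<open>m\<close> after \<open>a = Cyc \<alpha>\<close>, indices being taken
  modulo the length \<open>N\<close>, so that \<open>b = cyc half\<close>.  The two open arcs of the cycle between \<open>a\<close> and \<open>b\<close>
  are the sets of all \<open>cyc (e + i)\<close> with \<open>0 < i < half\<close>, for \<open>e = 0\<close> and for \<open>e = half\<close>.
\<close>

locale gap =
  fixes n \<alpha> :: nat
  assumes n_ge_4: "4 \<le> n"
begin

definition half :: nat where "half = 8 * n + 1"

definition N :: nat where "N = 16 * n + 2"

lemma N_pos [simp]: "0 < N"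
  by (simp add: N_def)

definition cyc :: "nat \<Rightarrow> vertex" where
  "cyc m = Cyc ((\<alpha> + m) mod N)"

abbreviation "G \<equiv> gap_graph n (cyc 0) (cyc half)"

text \<open>Unlike \<^const>\<open>Link\<close>, this includes both end-vertices of the path.\<close>

definition link_vertex :: "nat \<Rightarrow> nat \<Rightarrow> nat \<Rightarrow> nat \<Rightarrow> vertex" where
  "link_vertex i j k l = (if l = 0 then Px i j else if l < link_length n j k then Link i j k l else Qy k)"

text \<open>Each edge is listed in one direction only. \<open>edge_C\<close> has no bound on
  \<open>m\<close> because \<open>cyc\<close> is periodic, and so it covers the closing edge of the
  cycle.\<close>

inductive edge :: "vertex \<Rightarrow> vertex \<Rightarrow> bool" where
  edge_P: "i < 3 \<Longrightarrow> 1 \<le> j \<Longrightarrow> j < 2 * n \<Longrightarrow> edge (Px i j) (Px i (Suc j))"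
| edge_Q: "1 \<le> k \<Longrightarrow> k < 4 * n \<Longrightarrow> edge (Qy k) (Qy (Suc k))"
| edge_link: "i < 3 \<Longrightarrow> 1 \<le> j \<Longrightarrow> j \<le> 2 * n \<Longrightarrow> 1 \<le> k \<Longrightarrow> k \<le> 4 * n \<Longrightarrow> l < link_length n j k \<Longrightarrow>
    edge (link_vertex i j k l) (link_vertex i j k (Suc l))"
| edge_C: "edge (cyc m) (cyc (Suc m))"
| edge_ax: "edge (cyc 0) (Px 0 (Suc 0))"
| edge_ay: "edge (cyc 0) (Qy (Suc 0))"
| edge_bx: "edge (cyc half) (Px 0 (2 * n))"
| edge_by: "edge (cyc half) (Qy (4 * n))"

lemma link_length_ge: "n \<le> link_length n j k" "4 \<le> link_length n j k"
  using n_ge_4 by (auto simp: link_length_def)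

lemma link_length_le: "link_length n j k \<le> 5 * n"
  by (auto simp: link_length_def)

section \<open>Arithmetic of the cyclic indices\<close>

lemma Cyc_eq_cyc:
  assumes m: "m < N"
  obtains i where "i < N" "Cyc m = cyc i"
proof -
  \<comment> \<open>Adding \<open>N\<close> keeps the natural subtraction from truncating.\<close>
  define i where "i = (m + N - \<alpha> mod N) mod N"
  have "\<alpha> mod N < N" by simp
  then have *: "\<alpha> mod N + (m + N - \<alpha> mod N) = m + N" by linarith
  have "(\<alpha> + i) mod N = (\<alpha> mod N + (m + N - \<alpha> mod N)) mod N"
    unfolding i_def by (simp only: mod_add_left_eq mod_add_right_eq)
  also have "\<dots> = m" using m unfolding * by simp
  finally have "Cyc m = cyc i" by (simp add: cyc_def)
  moreover have "i < N" by (simp add: i_def)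
  ultimately show thesis using that by blast
qed

lemma cyc_eq_iff: "cyc x = cyc y \<longleftrightarrow> x mod N = y mod N"
proof -
  have "x mod N = y mod N" if xy: "(\<alpha> + x) mod N = (\<alpha> + y) mod N"
  proof -
    obtain q1 q2 where "\<alpha> + x + N * q1 = \<alpha> + y + N * q2"
      using xy nat_mod_eq_iff by blast
    then have "x + N * q1 = y + N * q2" by simp
    then show ?thesis using nat_mod_eq_iff by blast
  qed
  moreover have "(\<alpha> + x) mod N = (\<alpha> + y) mod N" if "x mod N = y mod N"
    using that by (rule mod_add_cong[OF refl])
  ultimately show ?thesis
    unfolding cyc_def by blast
qed

lemma cyc_eq_iff_less: "x < N \<Longrightarrow> y < N \<Longrightarrow> cyc x = cyc y \<longleftrightarrow> x = y"
  by (simp add: cyc_eq_iff)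

lemma cyc_shift: "cyc (x + N) = cyc x"
  by (simp add: cyc_eq_iff)

lemma cyc_neq [simp]: "cyc m \<noteq> Px i j" "cyc m \<noteq> Qy k" "cyc m \<noteq> Link i j k l"
  "Px i j \<noteq> cyc m" "Qy k \<noteq> cyc m" "Link i j k l \<noteq> cyc m"
  by (auto simp: cyc_def)

lemma pverts_C: "pverts (C_graph n) = Cyc ` {..<N}"
  by (auto simp: C_graph_def cycle_list_def N_def)

lemma cyc_in_C: "cyc m \<in> Cyc ` {..<N}"
  by (auto simp: cyc_def)

section \<open>From vertex lists to the adjacency relation\<close>

lemma P_arcs: "(u, v) \<in> set (vwalk_arcs (P_path n i)) \<longleftrightarrow>
    (\<exists>j. 1 \<le> j \<and> j < 2 * n \<and> u = Px i j \<and> v = Px i (Suc j))"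
proof
  assume "(u, v) \<in> set (vwalk_arcs (P_path n i))"
  then obtain l where "Suc l < 2 * n" "u = Px i (Suc l)" "v = Px i (Suc (Suc l))"
    by (auto simp: set_vwalk_arcs_conv_nth P_path_def simp del: upt_Suc)
  then show "\<exists>j. 1 \<le> j \<and> j < 2 * n \<and> u = Px i j \<and> v = Px i (Suc j)"
    by (intro exI[of _ "Suc l"]) auto
next
  assume "\<exists>j. 1 \<le> j \<and> j < 2 * n \<and> u = Px i j \<and> v = Px i (Suc j)"
  then obtain j where "1 \<le> j" "j < 2 * n" "u = Px i j" "v = Px i (Suc j)" by blast
  then show "(u, v) \<in> set (vwalk_arcs (P_path n i))"
    by (auto simp: set_vwalk_arcs_conv_nth P_path_def simp del: upt_Suc intro!: exI[of _ "j - 1"])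
qed

lemma Q_arcs: "(u, v) \<in> set (vwalk_arcs (Q_path n)) \<longleftrightarrow>
    (\<exists>k. 1 \<le> k \<and> k < 4 * n \<and> u = Qy k \<and> v = Qy (Suc k))"
proof
  assume "(u, v) \<in> set (vwalk_arcs (Q_path n))"
  then obtain l where "Suc l < 4 * n" "u = Qy (Suc l)" "v = Qy (Suc (Suc l))"
    by (auto simp: set_vwalk_arcs_conv_nth Q_path_def simp del: upt_Suc)
  then show "\<exists>k. 1 \<le> k \<and> k < 4 * n \<and> u = Qy k \<and> v = Qy (Suc k)"
    by (intro exI[of _ "Suc l"]) auto
next
  assume "\<exists>k. 1 \<le> k \<and> k < 4 * n \<and> u = Qy k \<and> v = Qy (Suc k)"
  then obtain k where "1 \<le> k" "k < 4 * n" "u = Qy k" "v = Qy (Suc k)" by blast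
  then show "(u, v) \<in> set (vwalk_arcs (Q_path n))"
    by (auto simp: set_vwalk_arcs_conv_nth Q_path_def simp del: upt_Suc intro!: exI[of _ "k - 1"])
qed

lemma length_link_path: "length (link_path n i j k) = Suc (link_length n j k)"
  using link_length_ge(2)[of j k] by (simp add: link_path_def)

lemma nth_link_path: "l \<le> link_length n j k \<Longrightarrow> link_path n i j k ! l = link_vertex i j k l"
  using link_length_ge(2)[of j k] by (auto simp: link_path_def link_vertex_def nth_Cons' nth_append)

lemma link_arcs: "(u, v) \<in> set (vwalk_arcs (link_path n i j k)) \<longleftrightarrow>
    (\<exists>l<link_length n j k. u = link_vertex i j k l \<and> v = link_vertex i j k (Suc l))"
proof
  assume "(u, v) \<in> set (vwalk_arcs (link_path n i j k))"
  then show "\<exists>l<link_length n j k. u = link_vertex i j k l \<and> v = link_vertex i j k (Suc l)"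
    by (auto simp: set_vwalk_arcs_conv_nth length_link_path nth_link_path)
next
  assume "\<exists>l<link_length n j k. u = link_vertex i j k l \<and> v = link_vertex i j k (Suc l)"
  then obtain l where "l < link_length n j k" "u = link_vertex i j k l" "v = link_vertex i j k (Suc l)" by blast
  then show "(u, v) \<in> set (vwalk_arcs (link_path n i j k))"
    using nth_link_path[of l j k i] nth_link_path[of "Suc l" j k i]
    unfolding set_vwalk_arcs_conv_nth length_link_path by (auto intro!: exI[of _ l])
qed

lemma cycle_arcs: "(u, v) \<in> set (vwalk_arcs (cycle_list n @ [hd (cycle_list n)])) \<longleftrightarrow>
    (\<exists>m. u = cyc m \<and> v = cyc (Suc m))"
proof -
  have cyc: "cycle_list n = map Cyc [0..<N]" "hd (cycle_list n) = Cyc 0"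
    by (simp_all add: cycle_list_def N_def hd_map del: upt_Suc)
  then have nth: "(cycle_list n @ [hd (cycle_list n)]) ! m = Cyc (m mod N)" if "m \<le> N" for m
    using that by (cases "m = N") (auto simp: nth_append)
  have len: "length (cycle_list n @ [hd (cycle_list n)]) = Suc N"
    by (simp add: cyc)
  show ?thesis
  proof
    assume "(u, v) \<in> set (vwalk_arcs (cycle_list n @ [hd (cycle_list n)]))"
    then obtain m where m: "m < N" "u = Cyc (m mod N)" "v = Cyc (Suc m mod N)"
      unfolding set_vwalk_arcs_conv_nth len using nth by (auto simp del: mod_Suc)
    obtain i where i: "Cyc m = cyc i" using Cyc_eq_cyc[OF m(1)] by blast
    then have "m = (\<alpha> + i) mod N" by (simp add: cyc_def)
    then have "Suc m mod N = (\<alpha> + Suc i) mod N" by (simp add: mod_Suc_eq)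
    then have "v = cyc (Suc i)" using m by (simp add: cyc_def)
    then show "\<exists>m. u = cyc m \<and> v = cyc (Suc m)" using m i by auto
  next
    assume "\<exists>m. u = cyc m \<and> v = cyc (Suc m)"
    then obtain m where m: "u = cyc m" "v = cyc (Suc m)" by blast
    define i where "i = (\<alpha> + m) mod N"
    have "i < N" by (simp add: i_def)
    have "u = Cyc (i mod N)" "v = Cyc (Suc i mod N)"
      using m by (simp_all add: cyc_def i_def mod_Suc_eq)
    then show "(u, v) \<in> set (vwalk_arcs (cycle_list n @ [hd (cycle_list n)]))"
      unfolding set_vwalk_arcs_conv_nth len using nth[of i] nth[of "Suc i"] \<open>i < N\<close> by force
  qed
qed

lemma arcs_iff: "(u, v) \<in> parcs G \<longleftrightarrow> edge u v \<or> edge v u"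
proof -
  have edge_iff: "edge u v \<longleftrightarrow>
      (\<exists>p\<in>all_paths n. (u, v) \<in> set (vwalk_arcs p)) \<or>
      (u, v) \<in> set (vwalk_arcs (cycle_list n @ [hd (cycle_list n)])) \<or>
      (u, v) \<in> {(cyc 0, Px 0 1), (cyc 0, Qy 1), (cyc half, Px 0 (2 * n)), (cyc half, Qy (4 * n))}"
    for u v
  proof -
    have three: "i < 3 \<longleftrightarrow> i \<in> {0, 1, 2}" for i :: nat
      by auto
    show ?thesis (is "_ \<longleftrightarrow> ?R1 \<or> ?R2 \<or> ?R3")
    proof
      assume "edge u v"
      then show "?R1 \<or> ?R2 \<or> ?R3"
      proof cases
        case (edge_P i j)
        then have "(u, v) \<in> set (vwalk_arcs (P_path n i))" using P_arcs by blast
        moreover have "P_path n i \<in> all_paths n" using edge_P three[of i] by (auto simp: all_paths_def)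
        ultimately show ?thesis by blast
      next
        case (edge_Q k)
        then have "(u, v) \<in> set (vwalk_arcs (Q_path n))" using Q_arcs by blast
        moreover have "Q_path n \<in> all_paths n" by (auto simp: all_paths_def)
        ultimately show ?thesis by blast
      next
        case (edge_link i j k l)
        then have "(u, v) \<in> set (vwalk_arcs (link_path n i j k))" using link_arcs by blast
        moreover have "link_path n i j k \<in> all_paths n"
          using edge_link three[of i] unfolding all_paths_def by auto
        ultimately show ?thesis by blast
      next
        case (edge_C m)
        then show ?thesis using cycle_arcs by blast
      qed auto
    next
      assume "?R1 \<or> ?R2 \<or> ?R3"
      then consider p where "p \<in> all_paths n" "(u, v) \<in> set (vwalk_arcs p)" | ?R2 | ?R3 by blast
      then show "edge u v"
      proof cases
        case p: (1 p)
        have P: "edge u v" if "p = P_path n i" "i \<in> {0, 1, 2}" for i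
          using p(2) that three[of i] unfolding that(1) P_arcs by (auto intro: edge_P)
        have Q: "edge u v" if "p = Q_path n"
          using p(2) unfolding that Q_arcs by (auto intro: edge_Q)
        have L: "edge u v" if ijk: "p = link_path n i j k" "i \<in> {0, 1, 2}" "j \<in> {1..2 * n}" "k \<in> {1..4 * n}"
          for i j k
        proof -
          obtain l where "l < link_length n j k" "u = link_vertex i j k l" "v = link_vertex i j k (Suc l)"
            using p(2) unfolding ijk(1) link_arcs by blast
          then show ?thesis using ijk three[of i] by (simp add: edge_link)
        qed
        have "p \<in> P_path n ` {0, 1, 2} \<or> p = Q_path n \<or> (\<exists>i j k. p = link_path n i j k \<and>
            i \<in> {0, 1, 2} \<and> j \<in> {1..2 * n} \<and> k \<in> {1..4 * n})"
          using p(1) unfolding all_paths_def Un_iff mem_Collect_eq singleton_iff by (simp only: disj_assoc)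
        then show ?thesis using P Q L by (elim disjE imageE exE conjE) simp_all
      next
        case 2
        then show ?thesis using cycle_arcs edge_C by auto
      qed (auto intro: edge.intros)
    qed
  qed
  show ?thesis
    unfolding gap_graph_def parcs_undirected C_graph_def edge_iff[of u v] edge_iff[of v u]
      Un_iff converse_iff UN_iff by argo
qed

lemma set_link_path:
  "set (link_path n i j k) = {Px i j, Qy k} \<union> Link i j k ` {1..<link_length n j k}"
  by (auto simp: link_path_def)

lemma pverts_G: "v \<in> pverts G \<longleftrightarrow> (case v of Px i j \<Rightarrow> i < 3 \<and> 1 \<le> j \<and> j \<le> 2 * n
    | Qy k \<Rightarrow> 1 \<le> k \<and> k \<le> 4 * n
    | Link i j k l \<Rightarrow> i < 3 \<and> 1 \<le> j \<and> j \<le> 2 * n \<and> 1 \<le> k \<and> k \<le> 4 * n \<and> 1 \<le> l \<and> l < link_length n j k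
    | Cyc m \<Rightarrow> m < N)"
proof -
  have three: "i < 3 \<longleftrightarrow> i \<in> {0, 1, 2}" for i :: nat
    by auto
  have "(\<exists>p\<in>all_paths n. v \<in> set p) \<longleftrightarrow>
      (\<exists>i<3. v \<in> set (P_path n i)) \<or> v \<in> set (Q_path n) \<or>
      (\<exists>i<3. \<exists>j\<in>{1..2 * n}. \<exists>k\<in>{1..4 * n}. v \<in> set (link_path n i j k))"
    unfolding all_paths_def three by blast
  also have "\<dots> \<longleftrightarrow> (case v of Px i j \<Rightarrow> i < 3 \<and> 1 \<le> j \<and> j \<le> 2 * n
      | Qy k \<Rightarrow> 1 \<le> k \<and> k \<le> 4 * n
      | Link i j k l \<Rightarrow> i < 3 \<and> 1 \<le> j \<and> j \<le> 2 * n \<and> 1 \<le> k \<and> k \<le> 4 * n \<and> 1 \<le> l \<and> l < link_length n j k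
      | Cyc m \<Rightarrow> False)"
    by (cases v) (auto simp: set_link_path P_path_def Q_path_def image_iff simp del: upt_Suc)
  finally show ?thesis
    unfolding gap_graph_def pverts_undirected pverts_C UN_iff Un_iff
    by (cases v) auto
qed

lemma sym_G: "sym (parcs G)"
  by (auto simp: sym_def arcs_iff)

lemma N_eq: "N = 2 * half" and half_gt: "8 * n < half" and half_pos [simp]: "0 < half"
  by (auto simp: N_def half_def)

lemma cyc_Suc_iff: "cyc (Suc x) = cyc (Suc y) \<longleftrightarrow> cyc x = cyc y"
proof
  assume "cyc (Suc x) = cyc (Suc y)"
  then obtain q1 q2 where "Suc x + N * q1 = Suc y + N * q2"
    unfolding cyc_eq_iff using nat_mod_eq_iff by blast
  then have "x + N * q1 = y + N * q2" by simp
  then show "cyc x = cyc y" unfolding cyc_eq_iff using nat_mod_eq_iff by blast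
next
  assume "cyc x = cyc y"
  then show "cyc (Suc x) = cyc (Suc y)" unfolding cyc_eq_iff by (metis mod_Suc_eq)
qed

lemma cyc_arc: "(cyc m, cyc (Suc m)) \<in> parcs G"
  by (simp add: arcs_iff edge_C)

lemma cyc_in_G: "cyc m \<in> pverts G"
  by (simp add: pverts_G cyc_def[of m])

text \<open>Stated for an arbitrary sequence of adjacent vertices, so that it applies to both
  directions around the cycle.\<close>

lemma graph_dist_C_le:
  assumes "\<And>k. k < m \<Longrightarrow> (f k, f (Suc k)) \<in> parcs (C_graph n)" "f 0 \<in> pverts (C_graph n)"
  shows "graph_dist (C_graph n) (f 0) (f m) \<le> ereal (real m)"
proof -
  have "parcs (C_graph n) = {(cyc m, cyc (Suc m)) | m. True} \<union> {(cyc m, cyc (Suc m)) | m. True}\<inverse>"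
    unfolding C_graph_def parcs_undirected using cycle_arcs by auto
  then have wf: "wf_digraph (with_proj (C_graph n))"
    by unfold_locales (auto simp: pverts_C cyc_in_C)
  interpret wf_digraph "with_proj (C_graph n)" by (rule wf)
  have "\<exists>p. awalk (f 0) p (f m) \<and> length p = m"
    using assms(1)
  proof (induction m)
    case 0
    then show ?case using assms(2) by (auto simp: awalk_Nil_iff)
  next
    case (Suc m)
    then obtain p where "awalk (f 0) p (f m)" "length p = m" by force
    moreover have "awalk (f m) [(f m, f (Suc m))] (f (Suc m))"
      using Suc.prems[of m] arc_implies_awalk[of "(f m, f (Suc m))"] by simp
    ultimately show ?case
      by (intro exI[of _ "p @ [(f m, f (Suc m))]"]) auto
  qed
  then obtain p where p: "awalk (f 0) p (f m)" "length p = m" by blast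
  have "awalk_cost (\<lambda>_. 1) p = real m"
    using p(2) by (simp add: awalk_cost_def sum_list_triv)
  then show ?thesis
    using min_cost_le_walk_cost[OF p(1), of "\<lambda>_. 1"] by (simp add: graph_dist_def)
qed

text \<open>Going round the cycle either way bounds the distance by \<open>i\<close> and by
  \<open>N - i\<close>. Since \<open>N = 2 * half\<close>, a distance of \<open>half\<close> makes
  both bounds tight.\<close>

lemma antipodal:
  assumes "b \<in> pverts (C_graph n)" "graph_dist (C_graph n) (cyc 0) b = ereal (real half)"
  shows "b = cyc half"
proof -
  obtain i where i: "i < N" "b = cyc i"
    using assms(1) Cyc_eq_cyc unfolding pverts_C by blast
  have arcs: "(cyc m, cyc (Suc m)) \<in> parcs (C_graph n)" "(cyc (Suc m), cyc m) \<in> parcs (C_graph n)" for m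
    unfolding C_graph_def parcs_undirected using cycle_arcs by auto
  have "graph_dist (C_graph n) (cyc 0) (cyc i) \<le> ereal (real i)"
    by (rule graph_dist_C_le) (auto simp: arcs pverts_C cyc_in_C)
  moreover have "graph_dist (C_graph n) (cyc (N - 0)) (cyc (N - (N - i))) \<le> ereal (real (N - i))"
  proof (rule graph_dist_C_le)
    fix k assume "k < N - i"
    then have "N - k = Suc (N - Suc k)" by simp
    then show "(cyc (N - k), cyc (N - Suc k)) \<in> parcs (C_graph n)" using arcs(2)[of "N - Suc k"] by simp
  qed (simp add: pverts_C cyc_in_C)
  ultimately have "half \<le> i" "half \<le> N - i"
    using i cyc_shift[of 0] assms(2) by auto
  then have "i = half" using i N_eq by linarith
  then show ?thesis using i by simp
qed

section \<open>Neighbourhoods and connected pieces\<close>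

lemma link_length_gt [simp]: "0 < link_length n j k" "Suc 0 < link_length n j k"
  using link_length_ge(2)[of j k] by simp_all

lemma arc_Link:
  assumes "(Link i j k l, v) \<in> parcs G"
  shows "v = link_vertex i j k (l - 1) \<or> v = link_vertex i j k (Suc l)"
  using assms unfolding arcs_iff
  by (auto elim!: edge.cases simp: link_vertex_def split: if_splits)

lemma arc_P:
  assumes "(Px i j, v) \<in> parcs G"
  shows "v = Px i (Suc j) \<or> (\<exists>j'. j = Suc j' \<and> v = Px i j') \<or> (\<exists>k. v = Link i j k 1) \<or>
    i = 0 \<and> (v = cyc 0 \<or> v = cyc half)"
  using assms unfolding arcs_iff
  by (auto elim!: edge.cases simp: link_vertex_def split: if_splits)

lemma arc_cyc:
  assumes "(cyc m, v) \<in> parcs G" "cyc m \<noteq> cyc 0" "cyc m \<noteq> cyc half"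
  shows "v = cyc (Suc m) \<or> (\<exists>m'. cyc m = cyc (Suc m') \<and> v = cyc m')"
proof -
  have neq: "cyc m \<noteq> link_vertex i j k l" "link_vertex i j k l \<noteq> cyc m" for i j k l m
    by (auto simp: link_vertex_def)
  show ?thesis
    using assms unfolding arcs_iff
    by (auto elim!: edge.cases simp: neq cyc_Suc_iff)
qed

text \<open>The conditions on \<open>i\<close> exclude exactly $a$ and $b$, the only vertices of the
  cycle with neighbours off it. Indexing from \<open>e\<close> lets one statement serve both
  arcs.\<close>

lemma arc_cyc_shifted:
  assumes e: "e = 0 \<or> e = half" and i: "0 < i" "i < N" "i \<noteq> half" and arc: "(cyc (e + i), v) \<in> parcs G"
  shows "v = cyc (e + (i - 1)) \<or> v = cyc (e + Suc i)"
proof -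
  have "cyc (e + i) \<noteq> cyc 0 \<and> cyc (e + i) \<noteq> cyc half"
  proof (cases "e = 0")
    case True
    then show ?thesis using i N_eq half_pos by (simp add: cyc_eq_iff_less)
  next
    case False
    then have [simp]: "e = half" using e by simp
    show ?thesis
    proof (cases "half + i < N")
      case True
      then show ?thesis using i N_eq half_pos by (simp add: cyc_eq_iff_less)
    next
      case False
      then have *: "cyc (half + i) = cyc (i - half)"
        using cyc_shift[of "i - half"] N_eq by (simp add: algebra_simps)
      show ?thesis
        unfolding \<open>e = half\<close> * using i N_eq half_pos False by (simp add: cyc_eq_iff_less)
    qed
  qed
  from arc_cyc[OF arc] this consider "v = cyc (Suc (e + i))" | m' where "cyc (e + i) = cyc (Suc m')" "v = cyc m'"
    by blast
  then show ?thesis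
  proof cases
    case (2 m')
    then have "cyc (Suc (e + (i - 1))) = cyc (Suc m')" using i by simp
    then show ?thesis using 2 cyc_Suc_iff by simp
  qed simp
qed

lemma cyc_add_iff: "cyc (e + x) = cyc (e + y) \<longleftrightarrow> cyc x = cyc y"
  by (induction e) (auto simp: cyc_Suc_iff)

lemma cyc_inj: "inj_on (\<lambda>i. cyc (e + i)) {0..<N}"
  by (rule inj_onI) (auto simp: cyc_add_iff cyc_eq_iff_less)

lemma connected_arc: "i \<le> j \<Longrightarrow> connected_set G ((\<lambda>i. cyc (e + i)) ` {i..j})"
  by (rule connected_set_path[OF sym_G]) (auto simp: cyc_in_G cyc_arc)

lemma Px_in_G: "i < 3 \<Longrightarrow> 1 \<le> j \<Longrightarrow> j \<le> 2 * n \<Longrightarrow> Px i j \<in> pverts G"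
  by (simp add: pverts_G)

lemma Qy_in_G: "1 \<le> k \<Longrightarrow> k \<le> 4 * n \<Longrightarrow> Qy k \<in> pverts G"
  by (simp add: pverts_G)

definition link_triple :: "nat \<Rightarrow> nat \<Rightarrow> nat \<Rightarrow> bool" where
  "link_triple i j k \<longleftrightarrow> i < 3 \<and> 1 \<le> j \<and> j \<le> 2 * n \<and> 1 \<le> k \<and> k \<le> 4 * n"

lemma link_vertex_in_G: "link_triple i j k \<Longrightarrow> link_vertex i j k l \<in> pverts G"
  by (auto simp: pverts_G link_vertex_def link_triple_def)

lemma arc_link_vertex: "link_triple i j k \<Longrightarrow> l < link_length n j k \<Longrightarrow> (link_vertex i j k l, link_vertex i j k (Suc l)) \<in> parcs G"
  by (simp add: arcs_iff edge_link link_triple_def)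

lemma link_vertex_simps [simp]: "link_vertex i j k 0 = Px i j" "link_vertex i j k (link_length n j k) = Qy k"
  "0 < l \<Longrightarrow> l < link_length n j k \<Longrightarrow> link_vertex i j k l = Link i j k l"
  using link_length_ge(2)[of j k] by (auto simp: link_vertex_def)

lemma connected_link:
  "link_triple i j k \<Longrightarrow> l \<le> m \<Longrightarrow> m \<le> link_length n j k \<Longrightarrow> connected_set G (link_vertex i j k ` {l..m})"
  by (rule connected_set_path[OF sym_G]) (auto simp: link_vertex_in_G arc_link_vertex)

lemma connected_P: "i < 3 \<Longrightarrow> 1 \<le> j \<Longrightarrow> j \<le> j' \<Longrightarrow> j' \<le> 2 * n \<Longrightarrow> connected_set G (Px i ` {j..j'})"
  by (rule connected_set_path[OF sym_G]) (auto simp: Px_in_G arcs_iff edge_P)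

lemma connected_Q: "connected_set G (Qy ` {1..4 * n})"
  by (rule connected_set_path[OF sym_G]) (use n_ge_4 in \<open>auto simp: Qy_in_G arcs_iff edge_Q\<close>)

end

section \<open>Covers of brambles\<close>

lemma connected_order_le:
  "bramble_cover G B S \<Longrightarrow> connected_set G S \<Longrightarrow> card S \<le> m \<Longrightarrow> connected_order G B \<le> enat m"
  unfolding connected_order_def by (rule INF_lower2[of S]) auto

lemma bramble_coverI:
  "connected_set G S \<Longrightarrow> (\<And>X. X \<in> B \<Longrightarrow> X \<inter> S \<noteq> {}) \<Longrightarrow> bramble_cover G B S"
  using connected_set_subset[of G S] unfolding bramble_cover_def by blast

text \<open>\<open>D\<close> contains the outer boundary of \<open>A\<close>; the connected set
  \<open>X \<union> Y\<close> starts inside \<open>A\<close> and cannot leave it without meeting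
  \<open>D\<close>. Three of the cover arguments rest on this.\<close>

lemma bramble_element_subset:
  assumes "sym (parcs G)" "bramble G B" "X \<in> B" "Y \<in> B" "X \<subseteq> A" "X \<inter> D = {}" "Y \<inter> D = {}"
    and bd: "\<And>v w. v \<in> A \<Longrightarrow> (v, w) \<in> parcs G \<Longrightarrow> w \<notin> A \<Longrightarrow> w \<in> D"
  shows "Y \<subseteq> A"
proof -
  have conn: "connected_set G X" "connected_set G (X \<union> Y)"
    using assms(2-4) by (auto simp: bramble_def)
  obtain x where "x \<in> X" using connected_set_nonempty[OF assms(1) conn(1)] by blast
  then have "X \<union> Y \<subseteq> A"
    using assms(5-7) bd by (intro connected_set_subsetI[OF assms(1) conn(2), of x]) blast+
  then show ?thesis by blast
qed

context gap
begin

lemma bramble_nonempty: "bramble G B \<Longrightarrow> X \<in> B \<Longrightarrow> X \<noteq> {}"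
  using connected_set_nonempty[OF sym_G] by (auto simp: bramble_def)

lemma bramble_subset: "bramble G B \<Longrightarrow> X \<in> B \<Longrightarrow> X \<subseteq> pverts G"
  using connected_set_subset by (auto simp: bramble_def)

text \<open>The cover is the whole link with both ends, at most \<open>5 * n + 1\<close> vertices:
  an element avoiding the ends is trapped in the interior together with \<open>X\<close>.\<close>

lemma order_if_in_link:
  assumes B: "bramble G B" and X: "X \<in> B" "X \<subseteq> Link i j k ` {1..<link_length n j k}"
  shows "connected_order G B \<le> enat (5 * n + 3)"
proof (rule connected_order_le)
  let ?S = "link_vertex i j k ` {0..link_length n j k}"
  obtain l where "Link i j k l \<in> X" using bramble_nonempty[OF B X(1)] X(2) by blast
  then have triple: "link_triple i j k"
    using bramble_subset[OF B X(1)] by (auto simp: pverts_G link_triple_def)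
  then show conn: "connected_set G ?S" by (simp add: connected_link)
  have "Link i j k l = link_vertex i j k l" if "l \<in> {1..<link_length n j k}" for l
    using that by simp
  then have sub: "Link i j k ` {1..<link_length n j k} \<subseteq> ?S" by fastforce
  have "Y \<inter> ?S \<noteq> {}" if Y: "Y \<in> B" for Y
  proof
    assume Y0: "Y \<inter> ?S = {}"
    have "Px i j \<in> ?S" "Qy k \<in> ?S"
      by (auto intro!: image_eqI[of "Px i j" _ 0] image_eqI[of "Qy k" _ "link_length n j k"])
    then have "Y \<subseteq> Link i j k ` {1..<link_length n j k}"
      using X Y0
      by (intro bramble_element_subset[OF sym_G B X(1) Y X(2), of "{Px i j, Qy k}"])
        (auto dest!: arc_Link simp: link_vertex_def split: if_splits)
    then show False using sub Y0 bramble_nonempty[OF B Y] by blast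
  qed
  then show "bramble_cover G B ?S"
    by (rule bramble_coverI[OF conn])
  have "card ?S \<le> Suc (link_length n j k)"
    using card_image_le[of "{0..link_length n j k}" "link_vertex i j k"] by simp
  then show "card ?S \<le> 5 * n + 3" using link_length_le[of j k] by simp
qed

lemma cyc_half_add_half: "cyc (half + half) = cyc 0"
  using cyc_shift[of 0] unfolding N_eq by (simp only: mult_2 add_0)

lemma arc_ends:
  assumes "e = 0 \<or> e = half"
  shows "{cyc e, cyc (e + half)} = {cyc 0, cyc half}"
  using assms cyc_half_add_half by auto

lemma arc_inner:
  assumes e: "e = 0 \<or> e = half" and v: "v \<in> (\<lambda>i. cyc (e + i)) ` {1..<half}" and vw: "(v, w) \<in> parcs G"
    and w: "w \<notin> (\<lambda>i. cyc (e + i)) ` {1..<half}"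
  shows "w \<in> {cyc 0, cyc half}"
proof -
  obtain i where "i \<in> {1..<half}" and v_eq: "v = cyc (e + i)" using v by blast
  then have i: "0 < i" "i < half" by auto
  then have "w = cyc (e + (i - 1)) \<or> w = cyc (e + Suc i)"
    using arc_cyc_shifted[OF e, of i w] vw v_eq N_eq by simp
  then have "w = cyc (e + 0) \<or> w = cyc (e + half)"
  proof
    assume *: "w = cyc (e + (i - 1))"
    then have "i - 1 \<notin> {1..<half}" using w by blast
    then show ?thesis using i * by (cases "i - 1 = 0") auto
  next
    assume *: "w = cyc (e + Suc i)"
    then have "Suc i \<notin> {1..<half}" using w by blast
    then show ?thesis using i * by (cases "Suc i = half") auto
  qed
  then show ?thesis using arc_ends[OF e] by auto
qed

lemma inner_arc_disjoint:
  assumes e: "e = 0 \<or> e = half"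
  shows "(\<lambda>i. cyc (e + i)) ` {1..<half} \<inter> {cyc 0, cyc half} = {}"
proof -
  have "cyc (e + i) \<notin> {cyc e, cyc (e + half)}" if "i \<in> {1..<half}" for i
    using that N_eq inj_on_eq_iff[OF cyc_inj[of e], of i 0] inj_on_eq_iff[OF cyc_inj[of e], of i half]
    by auto
  then show ?thesis unfolding arc_ends[OF e] by blast
qed

text \<open>Here \<open>X\<close> together with its two neighbours on the cycle is a cover.\<close>

lemma order_if_short_arc:
  assumes B: "bramble G B" and e: "e = 0 \<or> e = half"
    and X: "X \<in> B" "X \<subseteq> (\<lambda>i. cyc (e + i)) ` {1..<half}" "card X \<le> 5 * n + 1"
  shows "connected_order G B \<le> enat (5 * n + 3)"
proof -
  let ?d = "\<lambda>i. cyc (e + i)"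
  have inj: "?d i = ?d j \<longleftrightarrow> i = j" if "i < N" "j < N" for i j
    using inj_on_eq_iff[OF cyc_inj[of e]] that by simp
  have hN: "half < N" using N_eq half_pos by simp
  have connX: "connected_set G X" using B X(1) by (simp add: bramble_def)
  define I where "I = {i \<in> {1..<half}. ?d i \<in> X}"
  have I: "finite I" "I \<noteq> {}" "X = ?d ` I"
    using X(2) bramble_nonempty[OF B X(1)] unfolding I_def by auto
  define l r where "l = Min I" and "r = Max I"
  have l: "l \<in> I" "\<And>i. i \<in> I \<Longrightarrow> l \<le> i" and r: "r \<in> I" "\<And>i. i \<in> I \<Longrightarrow> i \<le> r"
    using I unfolding l_def r_def by auto
  have lr: "1 \<le> l" "l \<le> r" "r < half"
    using l r unfolding I_def by auto
  have dI: "i \<in> I" if "?d i \<in> X" "i < N" for i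
  proof -
    obtain q where "q \<in> I" "?d i = ?d q" using \<open>?d i \<in> X\<close> I(3) by auto
    then show ?thesis using inj[of i q] that hN by (auto simp: I_def)
  qed
  \<comment> \<open>\<open>X\<close> is a segment: a missing index \<open>m\<close> would cut the
    connected set \<open>X\<close> between \<open>?d l\<close> and \<open>?d r\<close>.\<close>
  have "{l..r} \<subseteq> I"
  proof
    fix m assume m: "m \<in> {l..r}"
    show "m \<in> I"
    proof (rule ccontr)
      assume "m \<notin> I"
      then have m': "l < m" "m < r" using m l(1) r(1) by (auto simp: order_less_le)
      have "X \<subseteq> ?d ` {l..<m}"
      proof (rule connected_set_subsetI[OF sym_G connX])
        show "?d l \<in> X" "?d l \<in> ?d ` {l..<m}" using l(1) m' by (auto simp: I_def)
      next
        fix v w assume v: "v \<in> ?d ` {l..<m}" and w: "w \<in> X" and vw: "(v, w) \<in> parcs G"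
        obtain i where i: "l \<le> i" "i < m" "v = ?d i" using v by auto
        then have "w = ?d (i - 1) \<or> w = ?d (Suc i)"
          using arc_cyc_shifted[OF e, of i w] vw lr m' N_eq by simp
        then obtain p where p: "w = ?d p" "p = i - 1 \<or> p = Suc i" by blast
        then have "p \<in> I" using dI[of p] w i m' lr hN by auto
        then have "p \<noteq> m" "l \<le> p" using \<open>m \<notin> I\<close> l(2) by auto
        then show "w \<in> ?d ` {l..<m}" using p i by auto
      qed
      moreover have "?d r \<in> X" using r(1) by (simp add: I_def)
      ultimately have "?d r \<in> ?d ` {l..<m}" by blast
      then obtain q where "q \<in> {l..<m}" "?d r = ?d q" by blast
      then show False using inj[of r q] m' lr hN by auto
    qed
  qed
  then have "I = {l..r}" using l r by auto
  then have Xeq: "X = ?d ` {l..r}" using I by simp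
  have "card X = card {l..r}"
    unfolding Xeq using lr hN by (intro card_image inj_on_subset[OF cyc_inj]) auto
  then have card: "r - l \<le> 5 * n" using X(3) lr by simp
  \<comment> \<open>Since \<open>1 \<le> l\<close> and \<open>r < half\<close>, no index leaves the
    closed arc; the segment has at most \<open>5 * n + 3\<close> vertices.\<close>
  let ?S = "?d ` {l - 1..Suc r}"
  have out: "?d (l - 1) \<notin> X" "?d (Suc r) \<notin> X"
    using dI[of "l - 1"] dI[of "Suc r"] l(2) r(2) lr hN by fastforce+
  show ?thesis
  proof (rule connected_order_le)
    show conn: "connected_set G ?S" using lr by (intro connected_arc) simp
    have "Y \<inter> ?S \<noteq> {}" if Y: "Y \<in> B" for Y
    proof
      assume Y0: "Y \<inter> ?S = {}"
      have "l - 1 \<in> {l - 1..Suc r}" "Suc r \<in> {l - 1..Suc r}" "{l..r} \<subseteq> {l - 1..Suc r}"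
        using lr by auto
      then have ends: "?d (l - 1) \<in> ?S" "?d (Suc r) \<in> ?S" "X \<subseteq> ?S"
        unfolding Xeq by blast+
      have "Y \<subseteq> X"
      proof (rule bramble_element_subset[OF sym_G B X(1) Y order_refl])
        show "X \<inter> {?d (l - 1), ?d (Suc r)} = {}" using out by blast
        show "Y \<inter> {?d (l - 1), ?d (Suc r)} = {}" using ends Y0 by blast
        fix v w assume v: "v \<in> X" and vw: "(v, w) \<in> parcs G" and w: "w \<notin> X"
        obtain i where i: "l \<le> i" "i \<le> r" "v = ?d i" using v Xeq by auto
        then have "w = ?d (i - 1) \<or> w = ?d (Suc i)"
          using arc_cyc_shifted[OF e, of i w] vw lr N_eq by simp
        then obtain p where p: "w = ?d p" "p = i - 1 \<or> p = Suc i" by blast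
        then have "p \<notin> {l..r}" using w Xeq by auto
        then have "p = l - 1 \<or> p = Suc r" using p i by auto
        then show "w \<in> {?d (l - 1), ?d (Suc r)}" using p by blast
      qed
      then show False using ends Y0 bramble_nonempty[OF B Y] by blast
    qed
    then show "bramble_cover G B ?S"
      by (rule bramble_coverI[OF conn])
    have "card ?S \<le> card {l - 1..Suc r}" by (rule card_image_le) simp
    then show "card ?S \<le> 5 * n + 3" using card lr by simp
  qed
qed

text \<open>
  The cover is the path $a P_0 b$ extended along the arc until fewer than \<open>5 * n + 2\<close> vertices remain.
\<close>

lemma order_if_long_arcs:
  assumes B: "bramble G B" and e: "e = 0 \<or> e = half"
    and X: "X \<in> B" "X \<subseteq> (\<lambda>i. cyc (e + i)) ` {1..<half}"
    and long: "\<And>Y. Y \<in> B \<Longrightarrow> Y \<subseteq> (\<lambda>i. cyc (e + i)) ` {1..<half} \<Longrightarrow> 5 * n + 2 \<le> card Y"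
  shows "connected_order G B \<le> enat (5 * n + 3)"
proof -
  let ?d = "\<lambda>i. cyc (e + i)"
  let ?P = "insert (cyc 0) (insert (cyc half) (Px 0 ` {1..2 * n}))"
  let ?S = "?P \<union> ?d ` {0..3 * n + 1}"
  have half_eq: "half = 8 * n + 1" by (simp add: half_def)
  have P: "connected_set G (Px 0 ` {1..2 * n})" using n_ge_4 by (intro connected_P) auto
  have Ph: "connected_set G (insert (cyc half) (Px 0 ` {1..2 * n}))"
    using n_ge_4 by (intro connected_set_insert[OF sym_G P, of "Px 0 (2 * n)"])
      (auto simp: cyc_in_G arcs_iff intro: edge.intros)
  have "connected_set G ?P"
    using n_ge_4 by (intro connected_set_insert[OF sym_G Ph, of "Px 0 (Suc 0)"])
      (auto simp: cyc_in_G arcs_iff intro: edge.intros)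
  moreover have "?d 0 \<in> ?P" using arc_ends[OF e] by auto
  moreover have "?d 0 \<in> ?d ` {0..3 * n + 1}" by (rule imageI) simp
  ultimately have conn: "connected_set G ?S"
    by (intro connected_set_Un[where z = "?d 0", OF sym_G _ connected_arc]) simp_all
  show ?thesis
  proof (rule connected_order_le[OF _ conn])
    have "Y \<inter> ?S \<noteq> {}" if Y: "Y \<in> B" for Y
    proof
      assume Y0: "Y \<inter> ?S = {}"
      have "Y \<subseteq> ?d ` {1..<half}"
      proof (rule bramble_element_subset[OF sym_G B X(1) Y X(2)])
        show "X \<inter> {cyc 0, cyc half} = {}" using X(2) inner_arc_disjoint[OF e] by blast
        show "Y \<inter> {cyc 0, cyc half} = {}" using Y0 by blast
      qed (rule arc_inner[OF e])
      then have sub: "Y \<subseteq> ?d ` {1..<half}" .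
      then have Y1: "5 * n + 2 \<le> card Y" by (rule long[OF Y])
      have "Y \<subseteq> ?d ` {3 * n + 2..<half}"
      proof
        fix v assume v: "v \<in> Y"
        then obtain i where i: "i \<in> {1..<half}" "v = ?d i" using sub by blast
        have "i \<notin> {0..3 * n + 1}" using Y0 v unfolding i(2) by blast
        then have "i \<in> {3 * n + 2..<half}" using i(1) by simp
        then show "v \<in> ?d ` {3 * n + 2..<half}" unfolding i(2) by (rule imageI)
      qed
      then have "card Y \<le> card (?d ` {3 * n + 2..<half})" by (intro card_mono) auto
      also have "\<dots> \<le> card {3 * n + 2..<half}" by (rule card_image_le) simp
      \<comment> \<open>The remaining \<open>5 * n - 1\<close> vertices of the arc are too few for
        \<open>Y\<close>.\<close>
      finally show False using Y1 half_eq by simp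
    qed
    then show "bramble_cover G B ?S"
      by (rule bramble_coverI[OF conn])
    \<comment> \<open>\<open>?d 0\<close> is $a$ or $b$ and already counted in \<open>?P\<close>;
      the total is \<open>2 * n + 2\<close> plus \<open>3 * n + 1\<close>.\<close>
    have "{0..3 * n + 1} = insert 0 {1..3 * n + 1}" by auto
    then have "?S = ?P \<union> ?d ` {1..3 * n + 1}" using \<open>?d 0 \<in> ?P\<close> by auto
    then have "card ?S \<le> card ?P + card (?d ` {1..3 * n + 1})" by (metis card_Un_le)
    moreover have "card (?d ` {1..3 * n + 1}) \<le> 3 * n + 1"
      using card_image_le[of "{1..3 * n + 1}" ?d] by simp
    moreover have "card ?P \<le> 2 * n + 2"
      using card_image_le[of "{1..2 * n}" "Px 0"] by (auto simp: card_insert_if)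
    ultimately show "card ?S \<le> 5 * n + 3" by simp
  qed
qed

text \<open>Contracts the interior of every link to its end on a \<open>P_path\<close>. Away from
  $aQb$, edges then change the position only along the path itself. The pairs also tell links at
  different $x^i_j$ apart when counting.\<close>

fun pos :: "vertex \<Rightarrow> (nat \<times> nat) option" where
  "pos (Px i j) = Some (i, j)"
| "pos (Link i j k l) = Some (i, j)"
| "pos _ = None"

lemma pos_step:
  assumes "(u, v) \<in> parcs G" "pos u = Some (i, j)" "\<And>k. v \<noteq> Qy k" "v \<noteq> cyc 0" "v \<noteq> cyc half"
  shows "pos v = Some (i, j) \<or> (\<exists>j'. u = Px i j \<and> v = Px i j' \<and> (j' = Suc j \<or> j = Suc j'))"
proof (cases u)
  case (Px i' j')
  then show ?thesis using assms arc_P[of i j v] by auto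
next
  case (Link i' j' k l)
  then show ?thesis using assms arc_Link[of i j k l v] by (auto simp: link_vertex_def split: if_splits)
qed (use assms in auto)

text \<open>
  The cover is $aQb$ together with a short link and an edge of some \<open>P_path n i\<close>: the elements avoiding
  $aQb$ all meet the same path, in pairwise touching intervals, so that an edge at the leftmost right end
  meets all of them.
\<close>

lemma order_otherwise:
  assumes B: "bramble G B"
    and no_link: "\<And>X i j k. X \<in> B \<Longrightarrow> \<not> X \<subseteq> Link i j k ` {1..<link_length n j k}"
    and no_arc: "\<And>X e. X \<in> B \<Longrightarrow> e = 0 \<or> e = half \<Longrightarrow> \<not> X \<subseteq> (\<lambda>i. cyc (e + i)) ` {1..<half}"
  shows "connected_order G B \<le> enat (5 * n + 3)"
proof -
  let ?Q = "insert (cyc 0) (insert (cyc half) (Qy ` {1..4 * n}))"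
  have Ph: "connected_set G (insert (cyc half) (Qy ` {1..4 * n}))"
    using n_ge_4 by (intro connected_set_insert[OF sym_G connected_Q, of "Qy (4 * n)"])
      (auto simp: cyc_in_G arcs_iff intro: edge.intros)
  have Q: "connected_set G ?Q"
    using n_ge_4 by (intro connected_set_insert[OF sym_G Ph, of "Qy (Suc 0)"])
      (auto simp: cyc_in_G arcs_iff intro: edge.intros)
  have card_Q: "card ?Q \<le> 4 * n + 2"
    using card_image_le[of "{1..4 * n}" Qy] by (auto simp: card_insert_if)
  define W where "W = {X \<in> B. X \<inter> ?Q = {}}"
  have W: "X \<in> B" "Qy k \<notin> X" "cyc 0 \<notin> X" "cyc half \<notin> X" if "X \<in> W" for X k
  proof -
    show "X \<in> B" "cyc 0 \<notin> X" "cyc half \<notin> X" using that by (auto simp: W_def)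
    then have "Qy k \<in> pverts G" if "Qy k \<in> X" using that bramble_subset[OF B] by blast
    then show "Qy k \<notin> X" using that by (fastforce simp: W_def pverts_G)
  qed
  show ?thesis
  proof (cases "W = {}")
    case True
    then have "bramble_cover G B ?Q"
      using connected_set_subset[OF Q] by (auto simp: bramble_cover_def W_def)
    then show ?thesis using card_Q by (intro connected_order_le[OF _ Q]) auto
  next
    case False
    \<comment> \<open>With no vertex on any \<open>P_path\<close> and none in \<open>?Q\<close>, the
      connected set \<open>X\<close> could not leave the interior of a link or an open arc, which
      the hypotheses exclude.\<close>
    have meets_P: "\<exists>i j. Px i j \<in> X" if X: "X \<in> W" for X
    proof -
      have connX: "connected_set G X" using B W(1)[OF X] by (simp add: bramble_def)
      obtain v where v: "v \<in> X" using bramble_nonempty[OF B W(1)[OF X]] by blast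
      then have vG: "v \<in> pverts G" using bramble_subset[OF B W(1)[OF X]] by blast
      show ?thesis
      proof (cases v)
        case (Px i j)
        then show ?thesis using v by blast
      next
        case (Qy k)
        then show ?thesis using v W(2)[OF X] by blast
      next
        case (Link i j k l)
        show ?thesis
        proof (rule ccontr)
          assume no: "\<nexists>i j. Px i j \<in> X"
          have "X \<subseteq> Link i j k ` {1..<link_length n j k}"
          proof (rule connected_set_subsetI[OF sym_G connX v])
            show "v \<in> Link i j k ` {1..<link_length n j k}" using Link vG by (auto simp: pverts_G)
          next
            fix x y assume "x \<in> Link i j k ` {1..<link_length n j k}" "y \<in> X" "(x, y) \<in> parcs G"
            then show "y \<in> Link i j k ` {1..<link_length n j k}"
              using no W(2)[OF X] by (auto dest!: arc_Link simp: link_vertex_def split: if_splits)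
          qed
          then show False using no_link W(1)[OF X] by blast
        qed
      next
        case (Cyc m)
        then have "m < N" using vG by (simp add: pverts_G)
        then obtain i where i: "i < N" "v = cyc i" using Cyc Cyc_eq_cyc by metis
        then have i': "i \<noteq> 0" "i \<noteq> half" using v W(3,4)[OF X] by metis+
        obtain e where e: "e = 0 \<or> e = half" "v \<in> (\<lambda>i. cyc (e + i)) ` {1..<half}"
        proof (cases "i < half")
          case True
          then show thesis using that[of 0] i i' by auto
        next
          case False
          then have "v = cyc (half + (i - half))" "i - half \<in> {1..<half}" using i i' N_eq by auto
          then show thesis using that[of half] by blast
        qed
        have "X \<subseteq> (\<lambda>i. cyc (e + i)) ` {1..<half}"
          by (rule connected_set_subsetI[OF sym_G connX v e(2)])
            (use arc_inner[OF e(1)] W(3,4)[OF X] in blast)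
        then show ?thesis using no_arc[OF W(1)[OF X] e(1)] by blast
      qed
    qed
    \<comment> \<open>\<open>j\<close> will be the smallest right end of an element of
      \<open>W\<close>, measured by the second index whatever the path; its minimality makes every
      element of \<open>W\<close> reach index \<open>j\<close> or beyond.\<close>
    define P where "P j \<longleftrightarrow> (\<exists>X\<in>W. \<forall>i' j'. Px i' j' \<in> X \<longrightarrow> j' \<le> j)" for j
    define j where "j = (LEAST j. P j)"
    have "\<exists>j. P j"
    proof -
      obtain X where X: "X \<in> W" using False by blast
      have "j' \<le> 2 * n" if "Px i' j' \<in> X" for i' j'
        using that bramble_subset[OF B W(1)[OF X]] by (auto simp: pverts_G)
      then show ?thesis using X unfolding P_def by blast
    qed
    then have "P j" unfolding j_def by (rule LeastI_ex)
    then obtain X where X: "X \<in> W" and X_le: "\<And>i' j'. Px i' j' \<in> X \<Longrightarrow> j' \<le> j"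
      unfolding P_def by blast
    have large: "\<exists>i' j'. Px i' j' \<in> Y \<and> j \<le> j'" if Y: "Y \<in> W" for Y
    proof (cases j)
      case 0
      then show ?thesis using meets_P[OF Y] by blast
    next
      case (Suc j0)
      then have "\<not> P j0" unfolding j_def using not_less_Least[of j0 P] by simp
      then show ?thesis using Y Suc unfolding P_def by (auto simp: not_le Suc_le_eq)
    qed
    obtain i where ij: "Px i j \<in> X" using large[OF X] X_le by (metis le_antisym)
    then have "Px i j \<in> pverts G" using bramble_subset[OF B W(1)[OF X]] by blast
    then have ij': "i < 3" "1 \<le> j" "j \<le> 2 * n" by (auto simp: pverts_G)
    \<comment> \<open>If \<open>Y\<close> missed both vertices, \<open>X \<union> Y\<close> could
      never pass from position \<open>j\<close> to \<open>Suc j\<close> on path \<open>i\<close>;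
      but \<open>Y\<close> reaches index \<open>j\<close> or beyond, so it would contain
      \<open>Px i j\<close>.\<close>
    have hit: "Px i j \<in> Y \<or> Px i (Suc j) \<in> Y" if Y: "Y \<in> W" for Y
    proof (rule ccontr)
      assume no: "\<not> (Px i j \<in> Y \<or> Px i (Suc j) \<in> Y)"
      have conn: "connected_set G (X \<union> Y)" using B W(1) X Y by (simp add: bramble_def)
      have "X \<union> Y \<subseteq> {v. \<exists>r\<le>j. pos v = Some (i, r)}"
      proof (rule connected_set_subsetI[OF sym_G conn, of "Px i j"])
        fix v w assume v: "v \<in> {v. \<exists>r\<le>j. pos v = Some (i, r)}" and w: "w \<in> X \<union> Y"
          and vw: "(v, w) \<in> parcs G"
        obtain r where r: "r \<le> j" "pos v = Some (i, r)" using v by blast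
        have "w \<noteq> Qy k" "w \<noteq> cyc 0" "w \<noteq> cyc half" for k using w W(2-4) X Y by blast+
        then consider "pos w = Some (i, r)" | r' where "w = Px i r'" "r' = Suc r \<or> r = Suc r'"
          using pos_step[OF vw r(2)] by blast
        then show "w \<in> {v. \<exists>r\<le>j. pos v = Some (i, r)}"
        proof cases
          case (2 r')
          have "r' \<noteq> Suc j" using 2 w no X_le[of i r'] by auto
          then show ?thesis using 2 r by auto
        qed (use r in auto)
      qed (use ij in auto)
      moreover obtain i' j' where "Px i' j' \<in> Y" "j \<le> j'" using large[OF Y] by blast
      ultimately have "pos (Px i' j') = Some (i, j)" by fastforce
      then show False using \<open>Px i' j' \<in> Y\<close> no by simp
    qed
    \<comment> \<open>The index \<open>n + j\<close> selects the link of length \<open>n\<close>;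
      its end on $Q$ is already counted, so only \<open>n\<close> vertices are added.\<close>
    let ?L = "link_vertex i j (n + j) ` {0..n}"
    have triple: "link_triple i j (n + j)" and len: "link_length n j (n + j) = n"
      using ij' by (auto simp: link_triple_def link_length_def)
    have Qy: "Qy (n + j) \<in> ?L" "Qy (n + j) \<in> ?Q"
      using len link_vertex_simps(2)[of i j "n + j"] ij' by (auto intro!: image_eqI[of _ _ n])
    have L: "connected_set G (?Q \<union> ?L)"
      using connected_link[OF triple, of 0 n] len Qy by (intro connected_set_Un[OF sym_G Q]) auto
    have "{0..n} = insert n {0..<n}" by auto
    then have "?Q \<union> ?L = ?Q \<union> link_vertex i j (n + j) ` {0..<n}"
      using Qy(2) len link_vertex_simps(2)[of i j "n + j"] by auto
    then have "card (?Q \<union> ?L) \<le> card ?Q + card (link_vertex i j (n + j) ` {0..<n})" by (metis card_Un_le)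
    also have "\<dots> \<le> 4 * n + 2 + n"
      using card_Q card_image_le[of "{0..<n}" "link_vertex i j (n + j)"] by simp
    finally have card_L: "card (?Q \<union> ?L) \<le> 5 * n + 2" by simp
    have Px: "Px i j \<in> ?Q \<union> ?L" by (auto intro!: image_eqI[of _ _ 0])
    \<comment> \<open>For \<open>j = 2 * n\<close> there is no next vertex, and
      \<open>Px i j\<close> alone meets all of \<open>W\<close>.\<close>
    define S where "S = (if j < 2 * n then insert (Px i (Suc j)) (?Q \<union> ?L) else ?Q \<union> ?L)"
    have "connected_set G (insert (Px i (Suc j)) (?Q \<union> ?L))" if "j < 2 * n"
      by (rule connected_set_insert[OF sym_G L Px])
        (use ij' that in \<open>simp_all add: Px_in_G arcs_iff edge_P\<close>)
    then have conn: "connected_set G S"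
      unfolding S_def using L by (cases "j < 2 * n") (simp_all only: if_True if_False)
    show ?thesis
    proof (rule connected_order_le[OF _ conn])
      have "Y \<inter> S \<noteq> {}" if Y: "Y \<in> B" for Y
      proof (cases "Y \<in> W")
        case True
        have "Suc j \<le> 2 * n" if "Px i (Suc j) \<in> Y"
          using that bramble_subset[OF B Y] by (auto simp: pverts_G)
        then show ?thesis using hit[OF True] Px unfolding S_def by auto
      next
        case False
        then show ?thesis using Y unfolding W_def S_def by auto
      qed
      then show "bramble_cover G B S"
        by (rule bramble_coverI[OF conn])
      show "card S \<le> 5 * n + 3"
        using card_L by (auto simp: S_def card_insert_if simp del: Un_insert_left)
    qed
  qed
qed

theorem connected_order_bramble_le:
  assumes B: "bramble G B"
  shows "connected_order G B \<le> enat (5 * n + 3)"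
proof (cases "\<exists>X\<in>B. \<exists>i j k. X \<subseteq> Link i j k ` {1..<link_length n j k}")
  case True
  then show ?thesis using order_if_in_link[OF B] by blast
next
  case no_link: False
  show ?thesis
  proof (cases "\<exists>X\<in>B. \<exists>e. (e = 0 \<or> e = half) \<and> X \<subseteq> (\<lambda>i. cyc (e + i)) ` {1..<half}")
    case True
    then obtain X e where X: "X \<in> B" "X \<subseteq> (\<lambda>i. cyc (e + i)) ` {1..<half}" and e: "e = 0 \<or> e = half"
      by blast
    show ?thesis
    proof (cases "\<exists>Y\<in>B. Y \<subseteq> (\<lambda>i. cyc (e + i)) ` {1..<half} \<and> card Y \<le> 5 * n + 1")
      case True
      then show ?thesis using order_if_short_arc[OF B e] by blast
    next
      case False
      then show ?thesis using order_if_long_arcs[OF B e X] by force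
    qed
  next
    case False
    then show ?thesis using order_otherwise[OF B] no_link by blast
  qed
qed

section \<open>Parts of size at most \<open>6 * n\<close>\<close>

definition XV :: "vertex set" where "XV = case_prod Px ` ({..<3} \<times> {1..2 * n})"

definition QV :: "vertex set" where "QV = Qy ` {1..4 * n}"

definition P0 :: "vertex set" where "P0 = Px 0 ` {1..2 * n}"

lemma mem_XV: "v \<in> XV \<longleftrightarrow> (\<exists>i j. v = Px i j \<and> i < 3 \<and> 1 \<le> j \<and> j \<le> 2 * n)"
  by (auto simp: XV_def)

lemma mem_QV: "v \<in> QV \<longleftrightarrow> (\<exists>k. v = Qy k \<and> 1 \<le> k \<and> k \<le> 4 * n)"
  by (auto simp: QV_def)

lemma P0_subset_XV: "P0 \<subseteq> XV"
  by (auto simp: P0_def mem_XV)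

lemma finite_XQP [simp]: "finite XV" "finite QV" "finite P0"
  by (auto simp: XV_def QV_def P0_def)

lemma card_XV: "card XV = 6 * n"
proof -
  have "card XV = card ({..<3::nat} \<times> {1..2 * n})"
    unfolding XV_def by (rule card_image) (auto simp: inj_on_def)
  then show ?thesis by (simp add: card_cartesian_product)
qed

lemma card_QV: "card QV = 4 * n" and card_P0: "card P0 = 2 * n"
  unfolding QV_def P0_def by (subst card_image; simp add: inj_on_def)+

lemma disjoint_XQ: "XV \<inter> QV = {}"
  by (auto simp: mem_XV mem_QV)

lemma finite_pverts: "finite (pverts G)"
proof -
  have "pverts G \<subseteq> XV \<union> QV \<union> Cyc ` {..<N} \<union>
      (\<lambda>(i, j, k, l). Link i j k l) ` ({..<3} \<times> {..2 * n} \<times> {..4 * n} \<times> {..<5 * n})"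
  proof
    fix v assume "v \<in> pverts G"
    then show "v \<in> XV \<union> QV \<union> Cyc ` {..<N} \<union>
      (\<lambda>(i, j, k, l). Link i j k l) ` ({..<3} \<times> {..2 * n} \<times> {..4 * n} \<times> {..<5 * n})"
      using less_le_trans[OF _ link_length_le]
      by (cases v) (auto simp: pverts_G mem_XV mem_QV image_iff)
  qed
  then show ?thesis by (rule finite_subset) auto
qed

lemma connected_finite: "connected_set G S \<Longrightarrow> finite S"
  using finite_subset[OF connected_set_subset finite_pverts] .

text \<open>The bound on the size corresponds to width at most \<open>6 * n - 1\<close>.\<close>

definition small :: "vertex set \<Rightarrow> bool" where
  "small S \<longleftrightarrow> connected_set G S \<and> card S \<le> 6 * n"

lemma small_finite: "small S \<Longrightarrow> finite S"
  by (simp add: small_def connected_finite)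

text \<open>Since \<open>card XV = 6 * n\<close>, the set \<open>S\<close> would be
  \<open>XV\<close> itself, which is disconnected: no edge joins two different $P_i$.\<close>

lemma XV_not_subset:
  assumes "small S"
  shows "\<not> XV \<subseteq> S"
proof
  assume "XV \<subseteq> S"
  then have "S = XV"
    using assms card_XV card_seteq[OF small_finite[OF assms], of XV] by (simp add: small_def)
  then have conn: "connected_set G XV" using assms by (simp add: small_def)
  have "XV \<subseteq> range (Px 0)"
  proof (rule connected_set_subsetI[OF sym_G conn])
    show "Px 0 1 \<in> XV" using n_ge_4 by (auto simp: mem_XV)
  qed (auto dest!: arc_P simp: mem_XV)
  moreover have "Px 1 1 \<in> XV" using n_ge_4 by (auto simp: mem_XV)
  ultimately have "Px 1 1 \<in> range (Px 0)" by (rule subsetD)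
  then show False by auto
qed

text \<open>Again \<open>S\<close> would equal this set of \<open>4 * n + 2 * n\<close> vertices, in
  which no edge joins $Q$ to $P_0$.\<close>

lemma QP_not_subset:
  assumes "small S"
  shows "\<not> QV \<union> P0 \<subseteq> S"
proof
  assume sub: "QV \<union> P0 \<subseteq> S"
  have "card (QV \<union> P0) = 6 * n"
    using disjoint_XQ P0_subset_XV by (subst card_Un_disjoint) (auto simp: card_QV card_P0)
  then have "S = QV \<union> P0"
    using assms sub card_seteq[OF small_finite[OF assms], of "QV \<union> P0"] by (simp add: small_def)
  then have conn: "connected_set G (QV \<union> P0)" using assms by (simp add: small_def)
  have "QV \<union> P0 \<subseteq> range (Px 0)"
  proof (rule connected_set_subsetI[OF sym_G conn])
    show "Px 0 1 \<in> QV \<union> P0" using n_ge_4 by (auto simp: P0_def)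
  qed (auto dest!: arc_P simp: P0_def mem_QV)
  moreover have "Qy 1 \<in> QV \<union> P0" using n_ge_4 by (auto simp: mem_QV)
  ultimately have "Qy 1 \<in> range (Px 0)" by (rule subsetD)
  then show False by auto
qed

section \<open>The component of the remaining vertices of the paths\<close>

lemma in_link_cases:
  assumes "v \<in> link_vertex i j k ` {0..link_length n j k}"
  shows "v = Px i j \<or> v = Qy k \<or> v \<in> Link i j k ` {1..<link_length n j k}"
  using assms by (auto simp: link_vertex_def image_iff split: if_splits)

text \<open>A connected set that enters the interior of a link without meeting its ends never gets
  out of it.\<close>

lemma link_avoids:
  assumes S: "connected_set G S" and "Px i j \<notin> S" "Qy k \<notin> S"
    and no: "\<not> S \<subseteq> Link i j k ` {1..<link_length n j k}"
  shows "link_vertex i j k ` {0..link_length n j k} \<inter> S = {}"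
proof (rule ccontr)
  assume "link_vertex i j k ` {0..link_length n j k} \<inter> S \<noteq> {}"
  then obtain v where v: "v \<in> S" "v \<in> Link i j k ` {1..<link_length n j k}"
    using in_link_cases assms(2,3) by (metis disjoint_iff)
  have "S \<subseteq> Link i j k ` {1..<link_length n j k}"
    by (rule connected_set_subsetI[OF sym_G S v])
      (use assms(2,3) in \<open>auto dest!: arc_Link simp: link_vertex_def split: if_splits\<close>)
  with no show False by blast
qed

lemma Px_Qy_in_link: "Px i j \<in> link_vertex i j k ` {0..link_length n j k}" "Qy k \<in> link_vertex i j k ` {0..link_length n j k}"
  by (auto intro: image_eqI[of _ _ 0] image_eqI[of _ _ "link_length n j k"])

text \<open>If \<open>S\<close> is inside one link, take a $y_k$ that is not an end of that link;
  otherwise any $y_k$ outside \<open>S\<close> works for all links.\<close>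

lemma ex_good_k:
  assumes S: "connected_set G S" and Q: "\<not> QV \<subseteq> S"
  obtains k where "1 \<le> k" "k \<le> 4 * n" "Qy k \<notin> S"
    "\<forall>i j. \<not> S \<subseteq> Link i j k ` {1..<link_length n j k}"
proof (cases "\<exists>i j k. S \<subseteq> Link i j k ` {1..<link_length n j k}")
  case True
  then obtain i j k where sub: "S \<subseteq> Link i j k ` {1..<link_length n j k}" by blast
  then obtain l where l: "Link i j k l \<in> S" using connected_set_nonempty[OF sym_G S] by blast
  define k' where "k' = (if k = 1 then 2 else 1 :: nat)"
  have "k' \<noteq> k" "1 \<le> k'" "k' \<le> 4 * n" using n_ge_4 by (auto simp: k'_def)
  then show thesis using that[of k'] l sub by auto
next
  case False
  then show thesis using Q that by (auto simp: subset_iff mem_QV)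
qed

lemma ex_good_j:
  assumes S: "connected_set G S" and x: "Px i0 j0 \<in> XV - S"
  obtains i j where "i < 3" "1 \<le> j" "j \<le> 2 * n" "Px i j \<notin> S"
    "\<not> S \<subseteq> Link i j k ` {1..<link_length n j k}"
proof (cases "\<exists>i j. S \<subseteq> Link i j k ` {1..<link_length n j k}")
  case True
  then obtain i j where sub: "S \<subseteq> Link i j k ` {1..<link_length n j k}" by blast
  then obtain l where l: "Link i j k l \<in> S" using connected_set_nonempty[OF sym_G S] by blast
  define j' where "j' = (if j = 1 then 2 else 1 :: nat)"
  have "j' \<noteq> j" "1 \<le> j'" "j' \<le> 2 * n" using n_ge_4 by (auto simp: j'_def)
  then show thesis using that[of 0 j'] l sub by auto
next
  case False
  then show thesis using x that[of i0 j0] by (auto simp: mem_XV)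
qed

text \<open>One good $y_k$ is a hub: its links to all $x^i_j$ outside \<open>S\<close> avoid
  \<open>S\<close>. Any other $y_m$ outside \<open>S\<close> is then attached to some $x^i_j$ by a
  link avoiding \<open>S\<close>.\<close>

lemma core_component:
  assumes S: "connected_set G S" and Q: "\<not> QV \<subseteq> S" and x: "x \<in> XV - S" and v: "v \<in> (XV \<union> QV) - S"
  shows "v \<in> component_avoiding G S x"
proof -
  have direct: "Qy k \<in> component_avoiding G S (Px i j)"
    if "link_triple i j k" "Px i j \<notin> S" "Qy k \<notin> S" "\<not> S \<subseteq> Link i j k ` {1..<link_length n j k}" for i j k
    using component_avoidingI[OF connected_link[OF that(1)] link_avoids[OF S that(2-4)] Px_Qy_in_link]
    by simp
  obtain k where k: "1 \<le> k" "k \<le> 4 * n" "Qy k \<notin> S"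
    "\<forall>i j. \<not> S \<subseteq> Link i j k ` {1..<link_length n j k}"
    by (rule ex_good_k[OF S Q])
  have XX: "y \<in> component_avoiding G S x" if "x \<in> XV - S" "y \<in> XV - S" for x y
  proof -
    have "Qy k \<in> component_avoiding G S z" if z: "z \<in> XV - S" for z
    proof -
      obtain i j where ij: "z = Px i j" "i < 3" "1 \<le> j" "j \<le> 2 * n" "Px i j \<notin> S"
        using z by (auto simp: mem_XV)
      show ?thesis
        unfolding ij(1) using ij k by (intro direct) (simp_all add: link_triple_def)
    qed
    then have "Qy k \<in> component_avoiding G S x" "Qy k \<in> component_avoiding G S y"
      using that by blast+
    then show ?thesis
      by (rule component_avoiding_trans[OF sym_G _ component_avoiding_sym])
  qed
  show ?thesis
  proof (cases "v \<in> XV")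
    case True
    then show ?thesis using XX x v by blast
  next
    case False
    then obtain m where m: "v = Qy m" "1 \<le> m" "m \<le> 4 * n" "Qy m \<notin> S" using v by (auto simp: mem_QV)
    obtain i0 j0 where "x = Px i0 j0" using x by (auto simp: mem_XV)
    then have "Px i0 j0 \<in> XV - S" using x by simp
    then obtain i j where ij: "i < 3" "1 \<le> j" "j \<le> 2 * n" "Px i j \<notin> S"
      "\<not> S \<subseteq> Link i j m ` {1..<link_length n j m}"
      by (rule ex_good_j[OF S])
    have 1: "Qy m \<in> component_avoiding G S (Px i j)"
      using direct[of i j m] ij m by (simp add: link_triple_def)
    have 2: "Px i j \<in> component_avoiding G S x"
      using XX[OF x, of "Px i j"] ij by (auto simp: mem_XV)
    show ?thesis
      unfolding m(1) by (rule component_avoiding_trans[OF sym_G 2 1])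
  qed
qed

text \<open>Otherwise the first inner vertex of the link lies in both components: it is reached from
  $y_k$ avoiding \<open>S\<close> and from $x^i_j$ avoiding \<open>S'\<close>.\<close>

lemma link_hit:
  assumes S: "connected_set G S" "\<not> QV \<subseteq> S" "x \<in> XV - S"
    and S': "connected_set G S'" "\<not> QV \<subseteq> S'" "x' \<in> XV - S'"
    and disj: "component_avoiding G S x \<inter> component_avoiding G S' x' = {}"
    and triple: "link_triple i j k" and ends: "Px i j \<notin> S'" "Qy k \<notin> S"
  shows "\<exists>l. Link i j k l \<in> S \<union> S'"
proof (rule ccontr)
  assume no: "\<nexists>l. Link i j k l \<in> S \<union> S'"
  let ?m = "link_length n j k"
  have m: "2 < ?m" using link_length_ge(2)[of j k] by simp
  have K: "connected_set G (link_vertex i j k ` {1..?m})" "connected_set G (link_vertex i j k ` {0..?m - 1})"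
    using m by (auto intro!: connected_link[OF triple])
  have disjK: "link_vertex i j k ` {1..?m} \<inter> S = {}" "link_vertex i j k ` {0..?m - 1} \<inter> S' = {}"
    using no ends by (auto simp: link_vertex_def split: if_splits)
  have in_K: "Link i j k 1 \<in> link_vertex i j k ` {1..?m}" "Qy k \<in> link_vertex i j k ` {1..?m}"
    "Link i j k 1 \<in> link_vertex i j k ` {0..?m - 1}" "Px i j \<in> link_vertex i j k ` {0..?m - 1}"
    using m by (auto intro: image_eqI[of _ _ 0] image_eqI[of _ _ 1] image_eqI[of _ _ "?m"])
  have 1: "Link i j k 1 \<in> component_avoiding G S (Qy k)"
    by (rule component_avoidingI[OF K(1) disjK(1) in_K(2,1)])
  have 2: "Qy k \<in> component_avoiding G S x"
    using core_component[OF S] ends triple by (auto simp: mem_QV link_triple_def)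
  have 3: "Link i j k 1 \<in> component_avoiding G S x"
    by (rule component_avoiding_trans[OF sym_G 2 1])
  have 4: "Link i j k 1 \<in> component_avoiding G S' (Px i j)"
    by (rule component_avoidingI[OF K(2) disjK(2) in_K(4,3)])
  have 5: "Px i j \<in> component_avoiding G S' x'"
    using core_component[OF S'] ends triple by (auto simp: mem_XV link_triple_def)
  have "Link i j k 1 \<in> component_avoiding G S' x'"
    by (rule component_avoiding_trans[OF sym_G 5 4])
  with 3 disj show False by blast
qed

text \<open>
  If the components are disjoint, then \<open>S \<union> S'\<close> contains \<open>XV \<union> QV\<close> and meets the interiors of so many
  links that its size exceeds \<open>12 * n\<close>.
\<close>

lemma core_components_meet:
  assumes S: "small S" "\<not> QV \<subseteq> S" "x \<in> XV - S"
    and S': "small S'" "\<not> QV \<subseteq> S'" "x' \<in> XV - S'"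
  shows "component_avoiding G S x \<inter> component_avoiding G S' x' \<noteq> {}"
proof
  assume disj: "component_avoiding G S x \<inter> component_avoiding G S' x' = {}"
  have conn: "connected_set G S" "connected_set G S'" and card: "card S \<le> 6 * n" "card S' \<le> 6 * n"
    using S S' by (auto simp: small_def)
  have fin: "finite S" "finite S'" using conn connected_finite by blast+
  have cover: "XV \<union> QV \<subseteq> S \<union> S'"
    using core_component[OF conn(1) S(2,3)] core_component[OF conn(2) S'(2,3)] disj by blast
  define M where "M = (S \<union> S') \<inter> {Link i j k l | i j k l. True}"
  \<comment> \<open>Each $x^i_j$ missing from \<open>S\<close> or \<open>S'\<close> forces an inner
    vertex on one of its own links; \<open>pos\<close> keeps those of different $x^i_j$
    apart.\<close>
  have hit: "pos v \<in> pos ` M" if "v \<in> (XV - S) \<union> (XV - S')" for v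
  proof -
    obtain i j where ij: "v = Px i j" "i < 3" "1 \<le> j" "j \<le> 2 * n" using \<open>v \<in> _\<close> by (auto simp: mem_XV)
    have "\<exists>k l. Link i j k l \<in> S \<union> S'"
    proof (cases "v \<in> S'")
      case False
      obtain k where "1 \<le> k" "k \<le> 4 * n" "Qy k \<notin> S" using S(2) by (auto simp: subset_iff mem_QV)
      then show ?thesis
        using link_hit[OF conn(1) S(2,3) conn(2) S'(2,3) disj, of i j k] ij False
        by (auto simp: link_triple_def)
    next
      case True
      then have "Px i j \<notin> S" using that ij by blast
      moreover obtain k where "1 \<le> k" "k \<le> 4 * n" "Qy k \<notin> S'"
        using S'(2) by (auto simp: subset_iff mem_QV)
      moreover have "component_avoiding G S' x' \<inter> component_avoiding G S x = {}"
        using disj by blast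
      ultimately show ?thesis
        using link_hit[OF conn(2) S'(2,3) conn(1) S(2,3), of i j k] ij
        by (auto simp: link_triple_def)
    qed
    then obtain k l where "Link i j k l \<in> M" unfolding M_def by blast
    then show ?thesis using ij by (auto intro: rev_image_eqI)
  qed
  have inj: "inj_on pos ((XV - S) \<union> (XV - S'))"
    by (auto simp: inj_on_def mem_XV)
  have finM: "finite M" unfolding M_def using fin by blast
  have "card ((XV - S) \<union> (XV - S')) = card (pos ` ((XV - S) \<union> (XV - S')))"
    using card_image[OF inj] by simp
  also have "\<dots> \<le> card (pos ` M)" using hit finM by (intro card_mono) auto
  also have "\<dots> \<le> card M" by (rule card_image_le[OF finM])
  finally have M: "card ((XV - S) \<union> (XV - S')) \<le> card M" .
  have X: "card ((XV - S) \<union> (XV - S')) = card (XV - S) + card (XV - S')"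
    using cover by (intro card_Un_disjoint) auto
  have "card (QV - S) + card (QV - S') = card ((QV - S) \<union> (QV - S'))"
    using cover by (intro card_Un_disjoint[symmetric]) auto
  also have "\<dots> \<le> card QV" by (intro card_mono) auto
  finally have Q: "card (QV - S) + card (QV - S') \<le> 4 * n" using card_QV by simp
  have card_XQ: "card (XV \<union> QV) = 10 * n"
    using card_Un_disjoint[OF _ _ disjoint_XQ] card_XV card_QV by simp
  have out: "4 * n \<le> card (XV - R) + card (QV - R)" if "finite R" "card R \<le> 6 * n" for R
  proof -
    have "card (XV \<union> QV) - card R \<le> card ((XV \<union> QV) - R)" by (rule diff_card_le_card_Diff[OF that(1)])
    also have "(XV \<union> QV) - R = (XV - R) \<union> (QV - R)" by blast
    also have "card \<dots> \<le> card (XV - R) + card (QV - R)" by (rule card_Un_le)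
    finally show ?thesis using card_XQ that(2) by simp
  qed
  have "M \<inter> (XV \<union> QV) = {}" by (auto simp: M_def mem_XV mem_QV)
  then have "card (XV \<union> QV) + card M = card ((XV \<union> QV) \<union> M)"
    using finM by (intro card_Un_disjoint[symmetric]) auto
  also have "\<dots> \<le> card (S \<union> S')"
    using cover fin by (intro card_mono) (auto simp: M_def)
  also have "\<dots> \<le> 12 * n" using card_Un_le[of S S'] card by simp
  finally have "card M \<le> 2 * n" using card_XQ by simp
  \<comment> \<open>The four differences from \<open>XV\<close> and \<open>QV\<close> add up to at
    least \<open>8 * n\<close>, of which \<open>QV\<close> accounts for at most
    \<open>4 * n\<close>; so \<open>M\<close> has at least \<open>4 * n\<close> vertices, not
    \<open>2 * n\<close>.\<close>
  then show False
    using M X Q out[OF fin(1) card(1)] out[OF fin(2) card(2)] n_ge_4 by simp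
qed

text \<open>
  \<open>level m Z\<close> changes by at most 1 along each edge except for those at $x^0_m$ and at the ends of
  the arc \<open>Z\<close> around \<open>a\<close>, and it rises from 0 at \<open>a\<close> to \<open>4 * n + 1\<close> at \<open>b\<close>.  This is possible since
  $x^i_j$ and $y_{n+j}$, the ends of a short link, get levels that differ by 0 or \<open>n\<close>.
\<close>

definition base_level :: "nat \<Rightarrow> nat \<Rightarrow> nat \<Rightarrow> nat" where
  "base_level m i j = (if i = 0 then (if j \<le> m then j else 2 * n + j) else n + j)"

text \<open>Clamping at \<open>q\<close> lets the level move in steps of 1 and then stay, so a link
  may be longer than the difference of levels.\<close>

definition towards :: "nat \<Rightarrow> nat \<Rightarrow> nat \<Rightarrow> nat" where
  "towards p q l = (if p \<le> q then min (p + l) q else max (p - l) q)"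

fun level :: "nat \<Rightarrow> vertex set \<Rightarrow> vertex \<Rightarrow> nat" where
  "level m Z (Px i j) = base_level m i j"
| "level m Z (Qy k) = k"
| "level m Z (Link i j k l) = towards (base_level m i j) k l"
| "level m Z (Cyc x) = (if Cyc x \<in> Z then 0 else 4 * n + 1)"

lemma level_cyc: "level m Z (cyc x) = (if cyc x \<in> Z then 0 else 4 * n + 1)"
  by (simp add: cyc_def)

text \<open>Every link is long enough for its level to reach \<open>k\<close> at the far end: the
  end levels differ by \<open>0\<close> or \<open>n\<close> on a short link and by less than
  \<open>4 * n\<close> on the others.\<close>

lemma level_link_vertex:
  assumes "link_triple i j k" "m \<le> 2 * n" "l \<le> link_length n j k"
  shows "level m Z (link_vertex i j k l) = towards (base_level m i j) k l"
  using assms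
  by (auto simp: link_vertex_def towards_def base_level_def link_triple_def link_length_def split: if_splits)

lemma cyc_mod: "cyc x = cyc (x mod N)"
  by (simp add: cyc_eq_iff)

lemma cyc_mem_image_iff: "x < N \<Longrightarrow> A \<subseteq> {0..<N} \<Longrightarrow> cyc x \<in> cyc ` A \<longleftrightarrow> x \<in> A"
  using inj_on_image_mem_iff[OF cyc_inj[of 0], of x A] by simp

lemma level_step:
  assumes m: "1 \<le> m" "m \<le> 2 * n" "Px 0 m \<notin> S"
    and i0: "0 < i0" "i0 < half" "cyc i0 \<notin> S" and i1: "half < i1" "i1 < N" "cyc i1 \<notin> S"
    and Z: "Z = cyc ` ({0..<i0} \<union> {i1<..<N})"
    and uv: "edge u v" "u \<in> S" "v \<in> S"
  shows "level m Z v \<le> Suc (level m Z u) \<and> level m Z u \<le> Suc (level m Z v)"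
proof -
  have cZ: "cyc x \<in> Z \<longleftrightarrow> x < i0 \<or> i1 < x" if "x < N" for x
    unfolding Z using that N_eq i0 i1 by (subst cyc_mem_image_iff) auto
  have hN: "half < N" using N_eq half_pos by simp
  have lev0: "level m Z (cyc 0) = 0" and levh: "level m Z (cyc half) = 4 * n + 1"
    using cZ[of 0] cZ[of half] i0 i1 hN by (auto simp: level_cyc)
  from uv(1) show ?thesis
  proof cases
    case (edge_P i j)
    then have "\<not> (i = 0 \<and> j = m)" using m uv by auto
    then show ?thesis using edge_P by (auto simp: base_level_def)
  next
    case (edge_link i j k l)
    then have "link_triple i j k" by (simp add: link_triple_def)
    then show ?thesis
      using level_link_vertex[of i j k m l Z] level_link_vertex[of i j k m "Suc l" Z] m edge_link
      by (auto simp: towards_def)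
  next
    case (edge_C x)
    \<comment> \<open>Reducing the index modulo \<open>N\<close> leaves the edge from
      \<open>N - 1\<close> back to \<open>0\<close> as the one separate case.\<close>
    define y where "y = x mod N"
    have y: "y < N" by (simp add: y_def)
    have u: "u = cyc y" and v: "v = cyc (Suc y)"
      using edge_C cyc_mod[of x] cyc_Suc_iff[of x y] by (simp_all add: y_def)
    have "y \<noteq> i0" "y \<noteq> i1" "Suc y \<noteq> i0" "Suc y \<noteq> i1"
      using uv(2,3) i0(3) i1(3) unfolding u v by metis+
    show ?thesis
    proof (cases "Suc y < N")
      case True
      have "y < i0 \<or> i1 < y \<longleftrightarrow> Suc y < i0 \<or> i1 < Suc y"
        using \<open>y \<noteq> i0\<close> \<open>y \<noteq> i1\<close> \<open>Suc y \<noteq> i0\<close> \<open>Suc y \<noteq> i1\<close> by auto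
      then show ?thesis unfolding u v level_cyc using cZ[OF True] cZ[OF y] by simp
    next
      case False
      then have "Suc y = N" using y by simp
      then have "v = cyc 0" unfolding v using cyc_shift[of 0] by simp
      moreover have "cyc y \<in> Z" using cZ[OF y] \<open>Suc y = N\<close> \<open>y \<noteq> i1\<close> i1(2) by auto
      ultimately show ?thesis using lev0 by (simp add: u level_cyc)
    qed
  next
    case edge_bx
    \<comment> \<open>Hence the last vertex of $P_0$ has level \<open>4 * n\<close>, one below that
      of $b$.\<close>
    then have "2 * n \<noteq> m" using m uv by auto
    then show ?thesis using edge_bx levh m(2) by (auto simp: base_level_def)
  qed (use lev0 levh m n_ge_4 in \<open>auto simp: base_level_def\<close>)
qed

text \<open>A discrete intermediate value argument: between $a$ and $b$ the connected set
  \<open>S\<close> takes every level from \<open>1\<close> to \<open>4 * n\<close>, while vertices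
  of the cycle only have levels \<open>0\<close> and \<open>4 * n + 1\<close>.\<close>

lemma card_crossing:
  assumes S: "connected_set G S" "cyc 0 \<in> S" "cyc half \<in> S"
    and m: "1 \<le> m" "m \<le> 2 * n" "Px 0 m \<notin> S"
    and i0: "0 < i0" "i0 < half" "cyc i0 \<notin> S" and i1: "half < i1" "i1 < N" "cyc i1 \<notin> S"
  shows "4 * n \<le> card (S - range cyc)"
proof -
  define Z where "Z = cyc ` ({0..<i0} \<union> {i1<..<N})"
  have step: "level m Z v \<le> Suc (level m Z u)" if "(u, v) \<in> parcs G" "u \<in> S" "v \<in> S" for u v
    using that level_step[OF m i0 i1 Z_def] unfolding arcs_iff by blast
  have "cyc 0 \<in> Z" using i0 by (auto simp: Z_def)
  have hN: "half < N" using N_eq half_pos by simp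
  have "cyc half \<notin> Z"
    unfolding Z_def using i0 i1 hN N_eq by (subst cyc_mem_image_iff) auto
  have "{1..4 * n} \<subseteq> level m Z ` (S - range cyc)"
  proof
    fix t assume t: "t \<in> {1..4 * n}"
    have "\<exists>v\<in>S. level m Z v = t"
    proof (rule ccontr)
      assume no: "\<not> (\<exists>v\<in>S. level m Z v = t)"
      have "S \<subseteq> {v. level m Z v < t}"
      proof (rule connected_set_subsetI[OF sym_G S(1,2)])
        show "cyc 0 \<in> {v. level m Z v < t}" using t \<open>cyc 0 \<in> Z\<close> by (simp add: level_cyc)
      next
        fix v w assume "v \<in> S" "v \<in> {v. level m Z v < t}" "w \<in> S" "(v, w) \<in> parcs G"
        then have "level m Z w \<le> t" "level m Z w \<noteq> t" using step[of v w] no by auto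
        then show "w \<in> {v. level m Z v < t}" by simp
      qed
      then show False using S(3) t \<open>cyc half \<notin> Z\<close> by (auto simp: level_cyc)
    qed
    then obtain v where v: "v \<in> S" "level m Z v = t" by blast
    then have "v \<notin> range cyc" using t by (auto simp: level_cyc split: if_splits)
    then show "t \<in> level m Z ` (S - range cyc)" using v by blast
  qed
  then have "card {1..4 * n} \<le> card (level m Z ` (S - range cyc))"
    using connected_finite[OF S(1)] by (intro card_mono) auto
  also have "\<dots> \<le> card (S - range cyc)"
    using connected_finite[OF S(1)] by (intro card_image_le) auto
  finally show ?thesis by simp
qed

section \<open>Components on the cycle\<close>

lemma card_cyc_image: "A \<subseteq> {0..<N} \<Longrightarrow> card (cyc ` A) = card A"
  using card_image[OF inj_on_subset[OF cyc_inj[of 0]]] by simp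

lemma range_cyc: "range cyc = (\<lambda>i. cyc (e + i)) ` {0..<N}"
proof -
  have "card ((\<lambda>i. cyc (e + i)) ` {0..<N}) = N"
    using card_image[OF cyc_inj[of e]] by simp
  moreover have range: "range cyc = cyc ` {0..<N}"
  proof
    show "range cyc \<subseteq> cyc ` {0..<N}"
    proof
      fix v assume "v \<in> range cyc"
      then obtain x where "v = cyc (x mod N)" using cyc_mod by auto
      then show "v \<in> cyc ` {0..<N}" by simp
    qed
  qed auto
  moreover have "card (cyc ` {0..<N}) = N" using card_cyc_image[of "{0..<N}"] by simp
  ultimately have "card ((\<lambda>i. cyc (e + i)) ` {0..<N}) = card (range cyc)" by simp
  moreover have "finite (range cyc)" unfolding range by simp
  moreover have "(\<lambda>i. cyc (e + i)) ` {0..<N} \<subseteq> range cyc" by blast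
  ultimately show ?thesis
    using card_subset_eq[of "range cyc" "(\<lambda>i. cyc (e + i)) ` {0..<N}"] by metis
qed

lemma card_range_cyc: "card (range cyc) = N"
  using range_cyc[of 0] card_cyc_image[of "{0..<N}"] by simp

text \<open>For connected \<open>S\<close>, a piece of the cycle whose vertices outside
  \<open>S\<close> lie in one component of \<open>G - S\<close>. If \<open>S\<close> contains both
  $a$ and $b$, it may separate the two arcs, so a single closed arc is taken.\<close>

definition large_part :: "vertex set \<Rightarrow> vertex set" where
  "large_part S = (if cyc 0 \<in> S \<and> cyc half \<in> S then cyc ` {0..half} else range cyc)"

lemma half_subset_large_part: "cyc ` {0..half} \<subseteq> large_part S"
  by (auto simp: large_part_def)

text \<open>The two ways round the cycle from the root to \<open>u\<close> cannot both be blocked: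
  one of them has no further vertex of $a$, $b$ in its interior, and a connected \<open>S\<close>
  blocking it would be trapped there.\<close>

lemma connected_to_root:
  assumes S: "connected_set G S" and e: "e = 0 \<or> e = half" "cyc e \<notin> S" and u: "u \<in> range cyc - S"
  shows "u \<in> component_avoiding G S (cyc e)"
proof -
  let ?d = "\<lambda>i. cyc (e + i)"
  obtain i where i: "i < N" "u = ?d i" using u range_cyc[of e] by auto
  have dN: "?d N = cyc e" using cyc_shift by simp
  have d0: "?d 0 = cyc e" by simp
  have ui: "?d i \<notin> S" using u i by simp
  show ?thesis
  proof (cases "?d ` {0..i} \<inter> S = {}")
    case True
    have "?d 0 \<in> ?d ` {0..i}" "?d i \<in> ?d ` {0..i}" by (rule imageI, simp)+
    then show ?thesis
      unfolding i(2) using component_avoidingI[OF connected_arc True] d0 by simp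
  next
    case nonempty: False
    show ?thesis
    proof (cases "?d ` {i..N} \<inter> S = {}")
      case True
      have "?d N \<in> ?d ` {i..N}" "?d i \<in> ?d ` {i..N}" 
        using i(1) by (intro imageI; simp)+
      then show ?thesis
        unfolding i(2) using component_avoidingI[OF connected_arc True, of "?d N" "?d i"] i(1)
        unfolding dN by simp
    next
      case False
      obtain p where p: "p \<le> i" "?d p \<in> S" using nonempty by auto
      obtain q where q: "i \<le> q" "q \<le> N" "?d q \<in> S" using False by auto
      have "p \<noteq> i" "p \<noteq> 0" "q \<noteq> i" "q \<noteq> N"
        using p q ui e(2) dN d0 by metis+
      with p q have pq: "0 < p" "p < i" "i < q" "q < N" by auto
      have trapped: "S \<subseteq> ?d ` {a<..<b}" if ab: "a < r" "r < b" "b \<le> N" "?d r \<in> S" "?d a \<notin> S" "?d b \<notin> S"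
        "half \<notin> {a<..<b}" for a b r
      proof (rule connected_set_subsetI[OF sym_G S ab(4)])
        show "?d r \<in> ?d ` {a<..<b}" using ab by simp
      next
        fix v w assume "v \<in> ?d ` {a<..<b}" and w: "w \<in> S" and vw: "(v, w) \<in> parcs G"
        then obtain x where x: "x \<in> {a<..<b}" "v = ?d x" by blast
        then have "x \<noteq> half" using ab(7) by metis
        then have "w = ?d (x - 1) \<or> w = ?d (Suc x)"
          using arc_cyc_shifted[OF e(1), of x w] vw x ab by simp
        then obtain y where y: "w = ?d y" "y = x - 1 \<or> y = Suc x" by blast
        have "y \<noteq> a" "y \<noteq> b" using w y(1) ab(5,6) by metis+
        then have "y \<in> {a<..<b}" using y(2) x(1) by auto
        then show "w \<in> ?d ` {a<..<b}" using y(1) by blast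
      qed
      have inj: "?d x = ?d y \<longleftrightarrow> x = y" if "x < N" "y < N" for x y
        using inj_on_eq_iff[OF cyc_inj[of e], of x y] that by simp
      show ?thesis
      proof (cases "i \<le> half")
        case True
        then have "S \<subseteq> ?d ` {0<..<i}"
          using trapped[of 0 p i] pq p(2) ui e(2) i(1) by simp
        then have "?d q \<in> ?d ` {0<..<i}" using q(3) by blast
        then obtain x where "x \<in> {0<..<i}" "?d q = ?d x" by blast
        then show ?thesis using inj[of q x] pq by simp
      next
        case False
        then have "S \<subseteq> ?d ` {i<..<N}"
          using trapped[of i q N] pq q(3) ui e(2) dN by simp
        then have "?d p \<in> ?d ` {i<..<N}" using p(2) by blast
        then obtain x where "x \<in> {i<..<N}" "?d p = ?d x" by blast
        then show ?thesis using inj[of p x] pq by simp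
      qed
    qed
  qed
qed

text \<open>If \<open>S\<close> contains $a$ and $b$, it cannot meet the arc strictly between two
  vertices outside \<open>S\<close>, since it would be trapped there, away from $a$. Otherwise $a$
  or $b$ lies outside \<open>S\<close> and serves as a root.\<close>

lemma large_part_component:
  assumes S: "connected_set G S" and v: "v \<in> large_part S - S" and w: "w \<in> large_part S - S"
  shows "w \<in> component_avoiding G S v"
proof (cases "cyc 0 \<in> S \<and> cyc half \<in> S")
  case False
  then obtain e where e: "e = 0 \<or> e = half" "cyc e \<notin> S" by blast
  have "v \<in> range cyc - S" "w \<in> range cyc - S" using v w False by (auto simp: large_part_def)
  then have "v \<in> component_avoiding G S (cyc e)" "w \<in> component_avoiding G S (cyc e)"
    using connected_to_root[OF S e] by blast+
  then show ?thesis
    using component_avoiding_trans[OF sym_G component_avoiding_sym] by blast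
next
  case True
  have ordered: "cyc j \<in> component_avoiding G S (cyc i)"
    if ij: "i \<le> j" "j \<le> half" "cyc i \<notin> S" "cyc j \<notin> S" for i j
  proof -
    have "cyc ` {i..j} \<inter> S = {}"
    proof (rule ccontr)
      assume "cyc ` {i..j} \<inter> S \<noteq> {}"
      then obtain k where k: "i \<le> k" "k \<le> j" "cyc k \<in> S" by auto
      have "k \<noteq> i" "k \<noteq> j" using k(3) ij(3,4) by metis+
      then have k': "i < k" "k < j" using k by auto
      have "S \<subseteq> cyc ` {i<..<j}"
      proof (rule connected_set_subsetI[OF sym_G S k(3)])
        show "cyc k \<in> cyc ` {i<..<j}" using k' by simp
      next
        fix v w assume "v \<in> cyc ` {i<..<j}" and w: "w \<in> S" and vw: "(v, w) \<in> parcs G"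
        then obtain x where x: "x \<in> {i<..<j}" "v = cyc x" by blast
        then have "w = cyc (x - 1) \<or> w = cyc (Suc x)"
          using arc_cyc_shifted[of 0 x w] vw x ij N_eq by simp
        then obtain y where y: "w = cyc y" "y = x - 1 \<or> y = Suc x" by blast
        have "y \<noteq> i" "y \<noteq> j" using w y(1) ij(3,4) by metis+
        then have "y \<in> {i<..<j}" using y(2) x(1) by auto
        then show "w \<in> cyc ` {i<..<j}" using y(1) by blast
      qed
      then have "cyc 0 \<in> cyc ` {i<..<j}" using True by blast
      then obtain x where "x \<in> {i<..<j}" "cyc 0 = cyc x" by blast
      then show False using cyc_eq_iff_less[of 0 x] ij N_eq by simp
    qed
    moreover have "connected_set G (cyc ` {i..j})" using connected_arc[of i j 0] ij(1) by simp
    ultimately show ?thesis using ij(1) by (intro component_avoidingI[of G "cyc ` {i..j}"]) auto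
  qed
  obtain i j where "v = cyc i" "i \<le> half" "w = cyc j" "j \<le> half"
    using v w True by (auto simp: large_part_def)
  then show ?thesis
    using ordered[of i j] ordered[of j i] component_avoiding_sym v w by (cases "i \<le> j") auto
qed

text \<open>Each half of the cycle has more than \<open>6 * n\<close> vertices, so \<open>S\<close>
  misses one in both, and \<open>card_crossing\<close> puts \<open>4 * n\<close> of its at most
  \<open>6 * n\<close> vertices off the cycle.\<close>

lemma card_crossing_cycle:
  assumes S: "small S" "cyc 0 \<in> S" "cyc half \<in> S" and P: "\<not> P0 \<subseteq> S"
  shows "card (S \<inter> range cyc) \<le> 2 * n"
proof -
  have conn: "connected_set G S" and card: "card S \<le> 6 * n" using S(1) by (auto simp: small_def)
  have fin: "finite S" using small_finite[OF S(1)] .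
  have miss: "\<exists>i\<in>A. cyc i \<notin> S" if "A \<subseteq> {0..<N}" "6 * n < card A" for A
  proof (rule ccontr)
    assume "\<not> (\<exists>i\<in>A. cyc i \<notin> S)"
    then have "cyc ` A \<subseteq> S" by blast
    then have "card (cyc ` A) \<le> card S" using fin by (rule card_mono[rotated])
    then show False using card_cyc_image[OF that(1)] card that(2) by simp
  qed
  obtain i0 where i0: "i0 < half" "cyc i0 \<notin> S"
    using miss[of "{0..<half}"] N_eq half_gt by auto
  obtain i1 where i1: "half \<le> i1" "i1 < N" "cyc i1 \<notin> S"
    using miss[of "{half..<N}"] N_eq half_gt by auto
  have "i0 \<noteq> 0" "i1 \<noteq> half" using i0 i1 S(2,3) by metis+
  moreover obtain m where "1 \<le> m" "m \<le> 2 * n" "Px 0 m \<notin> S"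
    using P unfolding P0_def image_subset_iff by auto
  ultimately have "4 * n \<le> card (S - range cyc)"
    using card_crossing[OF conn S(2,3), of m i0 i1] i0 i1 by simp
  moreover have "card S = card (S \<inter> range cyc) + card (S - range cyc)"
    using card_Int_Diff[OF fin, of "range cyc"] .
  ultimately show ?thesis using card by simp
qed

lemma card_half: "card (cyc ` {0..half}) = 8 * n + 2"
proof -
  have "half < N" using N_eq half_pos by linarith
  then have "{0..half} \<subseteq> {0..<N}" by auto
  then show ?thesis using card_cyc_image[of "{0..half}"] by (simp add: half_def)
qed

lemma ex_half_diff:
  assumes "small S"
  shows "\<exists>v. v \<in> cyc ` {0..half} - S"
proof (rule ccontr)
  assume "\<nexists>v. v \<in> cyc ` {0..half} - S"
  then have "cyc ` {0..half} \<subseteq> S" by blast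
  then have "card (cyc ` {0..half}) \<le> card S" using small_finite[OF assms] by (rule card_mono[rotated])
  then show False using assms card_half by (simp add: small_def)
qed

text \<open>If one of the sets contains both $a$ and $b$, together they have at most
  \<open>2 * n + 6 * n\<close> vertices on the cycle, fewer than a closed arc; otherwise at most
  \<open>12 * n\<close>, fewer than the whole cycle.\<close>

lemma cycle_components_meet:
  assumes S: "small S" "\<not> P0 \<subseteq> S" "v \<in> cyc ` {0..half} - S"
    and S': "small S'" "\<not> P0 \<subseteq> S'" "v' \<in> cyc ` {0..half} - S'"
  shows "component_avoiding G S v \<inter> component_avoiding G S' v' \<noteq> {}"
proof -
  have conn: "connected_set G S" "connected_set G S'" and card: "card S \<le> 6 * n" "card S' \<le> 6 * n"
    using S S' by (auto simp: small_def)
  have fin: "finite S" "finite S'" using conn connected_finite by blast+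
  have meet: "card (S \<inter> range cyc) + card (S' \<inter> range cyc) < card A \<Longrightarrow> A \<subseteq> range cyc \<Longrightarrow> \<exists>w\<in>A. w \<notin> S \<union> S'" for A
  proof (rule ccontr)
    assume A: "card (S \<inter> range cyc) + card (S' \<inter> range cyc) < card A" "A \<subseteq> range cyc"
      and "\<not> (\<exists>w\<in>A. w \<notin> S \<union> S')"
    then have "A \<subseteq> (S \<inter> range cyc) \<union> (S' \<inter> range cyc)" by blast
    then have "card A \<le> card ((S \<inter> range cyc) \<union> (S' \<inter> range cyc))"
      using fin by (intro card_mono) auto
    also have "\<dots> \<le> card (S \<inter> range cyc) + card (S' \<inter> range cyc)" by (rule card_Un_le)
    finally show False using A by simp
  qed
  have le: "card (S \<inter> range cyc) \<le> 6 * n" "card (S' \<inter> range cyc) \<le> 6 * n"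
    using card_mono[OF fin(1), of "S \<inter> range cyc"] card_mono[OF fin(2), of "S' \<inter> range cyc"] card by auto
  have "\<exists>w\<in>large_part S \<inter> large_part S'. w \<notin> S \<union> S'"
  proof (cases "(cyc 0 \<in> S \<and> cyc half \<in> S) \<or> (cyc 0 \<in> S' \<and> cyc half \<in> S')")
    case True
    then have "card (S \<inter> range cyc) \<le> 2 * n \<or> card (S' \<inter> range cyc) \<le> 2 * n"
      using card_crossing_cycle S S' by blast
    then have "\<exists>w\<in>cyc ` {0..half}. w \<notin> S \<union> S'"
      using le card_half by (intro meet) auto
    then show ?thesis using half_subset_large_part by blast
  next
    case False
    then have [simp]: "large_part S = range cyc" "large_part S' = range cyc" by (auto simp: large_part_def)
    have "12 * n < N" by (simp add: N_def)
    then show ?thesis using le card_range_cyc meet[of "range cyc"] by simp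
  qed
  then obtain w where "w \<in> large_part S - S" "w \<in> large_part S' - S'" by blast
  moreover have "v \<in> large_part S - S" "v' \<in> large_part S' - S'"
    using S(3) S'(3) half_subset_large_part by blast+
  ultimately have "w \<in> component_avoiding G S v" "w \<in> component_avoiding G S' v'"
    using large_part_component conn by blast+
  then show ?thesis by blast
qed

section \<open>Adjacent parts that contain Q and P_0\<close>

lemma card_le_links:
  assumes "finite Z" and "\<And>j k. j \<in> A \<Longrightarrow> k \<in> B \<Longrightarrow> \<exists>l. Link i j k l \<in> Z"
  shows "card A * card B \<le> card (Z \<inter> {Link i j k l | j k l. j \<in> A \<and> k \<in> B})"
proof -
  let ?M = "Z \<inter> {Link i j k l | j k l. j \<in> A \<and> k \<in> B}"
  let ?f = "\<lambda>v. case v of Link i j k l \<Rightarrow> (j, k) | _ \<Rightarrow> (0, 0)"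
  have "A \<times> B \<subseteq> ?f ` ?M"
  proof
    fix e assume "e \<in> A \<times> B"
    then obtain j k where e: "e = (j, k)" "j \<in> A" "k \<in> B" by blast
    then obtain l where "Link i j k l \<in> ?M" using assms(2) by blast
    then show "e \<in> ?f ` ?M" using e by (intro image_eqI[of _ _ "Link i j k l"]) simp_all
  qed
  then have "card (A \<times> B) \<le> card (?f ` ?M)" using assms(1) by (intro card_mono) auto
  also have "\<dots> \<le> card ?M" using assms(1) by (intro card_image_le) auto
  finally show ?thesis by (simp add: card_cartesian_product)
qed

text \<open>
  With \<open>p\<close> vertices of \<open>P0\<close> outside \<open>S\<close> and \<open>q\<close> vertices of \<open>QV\<close> outside \<open>S'\<close>, at least \<open>p * q\<close> inner link
  vertices would lie in \<open>S \<inter> S'\<close>, which makes \<open>S\<close> or \<open>S'\<close> larger than \<open>6 * n\<close>.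
\<close>

lemma adjacent_parts_too_large:
  assumes S: "small S" "QV \<subseteq> S" and S': "small S'" "\<not> QV \<subseteq> S'" "P0 \<subseteq> S'"
  shows "\<exists>j k. link_triple 0 j k \<and> Px 0 j \<notin> S \<and> Qy k \<notin> S' \<and> (\<forall>l. Link 0 j k l \<notin> S \<inter> S')"
proof (rule ccontr)
  assume no: "\<not> ?thesis"
  define A B where "A = {j \<in> {1..2 * n}. Px 0 j \<notin> S}" and "B = {k \<in> {1..4 * n}. Qy k \<notin> S'}"
  define M where "M = (S \<inter> S') \<inter> {Link 0 j k l | j k l. j \<in> A \<and> k \<in> B}"
  have conn: "connected_set G S" and card: "card S \<le> 6 * n" "card S' \<le> 6 * n"
    using S S' by (auto simp: small_def)
  have fin: "finite S" "finite S'" using S(1) S'(1) small_finite by blast+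
  have M: "card A * card B \<le> card M"
    unfolding M_def using no fin
    by (intro card_le_links) (auto simp: A_def B_def link_triple_def)
  have finM: "finite M" unfolding M_def using fin by blast
  have "\<not> P0 \<subseteq> S" using QP_not_subset[OF S(1)] S(2) by blast
  then have "A \<noteq> {}" unfolding P0_def image_subset_iff by (auto simp: A_def)
  moreover have "B \<noteq> {}" using S'(2) unfolding QV_def image_subset_iff by (auto simp: B_def)
  moreover have fins: "finite A" "finite B" by (auto simp: A_def B_def)
  ultimately have pos: "0 < card A" "0 < card B" by (simp_all add: card_gt_0_iff)
  have "P0 - S = Px 0 ` A" by (auto simp: P0_def A_def)
  then have "card (P0 - S) = card A" by (simp add: card_image inj_on_def)
  then have P: "card (P0 \<inter> S) + card A = 2 * n" "card A \<le> 2 * n"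
    using card_Int_Diff[of P0 S] card_P0 by simp_all
  have "QV - S' = Qy ` B" by (auto simp: QV_def B_def)
  then have "card (QV - S') = card B" by (simp add: card_image inj_on_def)
  then have Q: "card (QV \<inter> S') + card B = 4 * n"
    using card_Int_Diff[of QV S'] card_QV by simp
  have "QV \<inter> P0 = {}" "(QV \<union> P0) \<inter> M = {}"
    by (auto simp: QV_def P0_def M_def)
  then have cards: "card (QV \<union> (P0 \<inter> S) \<union> M) = card QV + card (P0 \<inter> S) + card M"
    "card ((QV \<inter> S') \<union> P0 \<union> M) = card (QV \<inter> S') + card P0 + card M"
    using finM by (subst card_Un_disjoint; auto)+
  have sub: "QV \<union> (P0 \<inter> S) \<union> M \<subseteq> S" "(QV \<inter> S') \<union> P0 \<union> M \<subseteq> S'"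
    using S(2) S'(3) by (auto simp: M_def)
  \<comment> \<open>\<open>QV\<close> and \<open>P0 \<inter> S\<close> already take
    \<open>6 * n - card A\<close> vertices of \<open>S\<close>.\<close>
  have 1: "card M \<le> card A"
    using card_mono[OF fin(1) sub(1)] cards(1) card(1) card_QV P by simp
  have 2: "card M \<le> card B"
    using card_mono[OF fin(2) sub(2)] cards(2) card(2) card_P0 Q by simp
  have "card A = 2 * n"
  proof (rule ccontr)
    assume "card A \<noteq> 2 * n"
    then have "P0 \<inter> S \<noteq> {}" using P by auto
    then obtain x where x: "x \<in> S" "x \<in> P0" by blast
    \<comment> \<open>The links counted in \<open>M\<close> start at vertices of $P_0$ outside
      \<open>S\<close>, so a connected \<open>S\<close> that meets both $P_0$ and $Q$ needs a
      further vertex; this makes the bound on \<open>card M\<close> strict.\<close>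
    have "\<exists>w\<in>S. w \<notin> QV \<union> (P0 \<inter> S) \<union> M"
    proof (rule ccontr)
      assume none: "\<not> (\<exists>w\<in>S. w \<notin> QV \<union> (P0 \<inter> S) \<union> M)"
      have "S \<subseteq> P0"
      proof (rule connected_set_subsetI[OF sym_G conn x])
        fix v w assume "v \<in> S" "v \<in> P0" and w: "w \<in> S" and vw: "(v, w) \<in> parcs G"
        then obtain j where j: "v = Px 0 j" "j \<notin> A" by (auto simp: P0_def A_def)
        have "w \<in> pverts G" using w connected_set_subset[OF conn] by blast
        moreover have "w \<in> QV \<union> P0 \<union> M" using none w by blast
        ultimately show "w \<in> P0"
          using arc_P[of 0 j w] vw j by (auto simp: QV_def M_def)
      qed
      moreover have "Qy 1 \<in> S" using S(2) n_ge_4 by (auto simp: QV_def)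
      ultimately show False by (auto simp: P0_def)
    qed
    then have "QV \<union> (P0 \<inter> S) \<union> M \<subset> S" using sub(1) by blast
    then have "card (QV \<union> (P0 \<inter> S) \<union> M) < card S" using fin(1) by (intro psubset_card_mono)
    then have "card M < card A" using cards(1) card(1) card_QV P by simp
    moreover have "card A \<le> card A * card B" using pos by simp
    ultimately show False using M by simp
  qed
  \<comment> \<open>Together with \<open>card A = 2 * n\<close>, the chain
    \<open>card A * card B \<le> card M \<le> card B\<close> is impossible for non-empty
    \<open>B\<close>.\<close>
  moreover have "card A * card B \<le> 1 * card B" using order_trans[OF M 2] by (simp only: mult_1)
  then have "card A \<le> 1" using pos(2) by (simp only: mult_le_cancel2)
  ultimately show False using n_ge_4 by simp
qed

lemma no_small_decomposition:
  assumes decomp: "connected_tree_decomposition G T V" and "\<And>t. t \<in> pverts T \<Longrightarrow> card (V t) \<le> 6 * n"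
  shows False
proof -
  interpret tree_decomp T G V
    using decomp sym_G by unfold_locales
      (auto simp: connected_tree_decomposition_def tree_decomposition_def)
  have small: "small (V t)" if "t \<in> pverts T" for t
    using assms that by (auto simp: small_def connected_tree_decomposition_def)
  have conn: "connected_set G (V t)" if "t \<in> pverts T" for t
    using small[OF that] by (simp add: small_def)
  have c_in: "cyc ` {0..half} \<subseteq> pverts G" using cyc_in_G by blast
  have X_in: "XV \<subseteq> pverts G" by (auto simp: mem_XV Px_in_G)
  \<comment> \<open>Otherwise the components of the vertices of \<open>XV\<close> outside the parts
    contradict \<open>no_haven\<close>.\<close>
  have "\<exists>tQ\<in>pverts T. QV \<subseteq> V tQ"
  proof (rule ccontr)
    assume none: "\<not> (\<exists>tQ\<in>pverts T. QV \<subseteq> V tQ)"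
    have "\<forall>t\<in>pverts T. \<exists>x. x \<in> XV - V t" using XV_not_subset small by blast
    then obtain x where x: "\<And>t. t \<in> pverts T \<Longrightarrow> x t \<in> XV - V t" by metis
    show False
    proof (rule no_haven[of "\<lambda>t. component_avoiding G (V t) (x t)"])
      fix t assume t: "t \<in> pverts T"
      show "connected_set G (component_avoiding G (V t) (x t))"
        using x[OF t] X_in by (intro connected_component_avoiding[OF sym_G]) auto
      show "component_avoiding G (V t) (x t) \<inter> V t = {}" by (rule component_avoiding_disjoint)
    next
      fix t t' assume "t \<in> pverts T" "t' \<in> pverts T"
      then show "component_avoiding G (V t) (x t) \<inter> component_avoiding G (V t') (x t') \<noteq> {}"
        using none small x by (intro core_components_meet) blast+
    qed
  qed
  then obtain tQ where tQ: "tQ \<in> pverts T" "QV \<subseteq> V tQ" by blast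
  \<comment> \<open>The same argument with the components on the cycle.\<close>
  have "\<exists>tP\<in>pverts T. P0 \<subseteq> V tP"
  proof (rule ccontr)
    assume none: "\<not> (\<exists>tP\<in>pverts T. P0 \<subseteq> V tP)"
    have "\<forall>t\<in>pverts T. \<exists>v. v \<in> cyc ` {0..half} - V t" using ex_half_diff small by blast
    then obtain v where v: "\<And>t. t \<in> pverts T \<Longrightarrow> v t \<in> cyc ` {0..half} - V t" by metis
    show False
    proof (rule no_haven[of "\<lambda>t. component_avoiding G (V t) (v t)"])
      fix t assume t: "t \<in> pverts T"
      show "connected_set G (component_avoiding G (V t) (v t))"
        using v[OF t] c_in by (intro connected_component_avoiding[OF sym_G]) auto
      show "component_avoiding G (V t) (v t) \<inter> V t = {}" by (rule component_avoiding_disjoint)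
    next
      fix t t' assume "t \<in> pverts T" "t' \<in> pverts T"
      then show "component_avoiding G (V t) (v t) \<inter> component_avoiding G (V t') (v t') \<noteq> {}"
        using none small v by (intro cycle_components_meet) blast+
    qed
  qed
  then obtain tP where tP: "tP \<in> pverts T" "P0 \<subseteq> V tP" by blast
  have not_both: "\<not> (QV \<subseteq> V t \<and> P0 \<subseteq> V t)" if "t \<in> pverts T" for t
    using QP_not_subset[OF small[OF that]] by blast
  define R where "R t t' \<longleftrightarrow> (t, t') \<in> parcs T \<and> QV \<subseteq> V t \<and> tP \<in> branch T t t'" for t t'
  have ex_R: "\<exists>t'. R t t'" if t: "t \<in> pverts T" "QV \<subseteq> V t" for t
  proof -
    have "tP \<noteq> t" using not_both[OF t(1)] t(2) tP(2) by blast
    then obtain t' where "(t, t') \<in> parcs T" "tP \<in> branch T t t'"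
      by (rule ex_branch[OF tP(1) t(1)])
    then show ?thesis using t(2) by (auto simp: R_def)
  qed
  obtain t1 where "R tQ t1" using ex_R[OF tQ] ..
  \<comment> \<open>Minimality of the branch ensures that the next part \<open>V t'\<close> on the
    way to \<open>tP\<close> no longer contains $Q$.\<close>
  then obtain p where "R (fst p) (snd p)"
    and "\<And>q. R (fst q) (snd q) \<Longrightarrow> card (branch T (fst p) (snd p)) \<le> card (branch T (fst q) (snd q))"
    using ex_has_least_nat[of "\<lambda>p. R (fst p) (snd p)" "(tQ, t1)"
      "\<lambda>p. card (branch T (fst p) (snd p))"] by auto
  then obtain t t' where tt': "R t t'"
    and min: "\<And>s s'. R s s' \<Longrightarrow> card (branch T t t') \<le> card (branch T s s')"
    by (metis fst_conv snd_conv)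
  have arc: "(t, t') \<in> parcs T" and Qt: "QV \<subseteq> V t" and tP_branch: "tP \<in> branch T t t'"
    using tt' by (simp_all add: R_def)
  have verts: "t \<in> pverts T" "t' \<in> pverts T" using arc wellformed' by blast+
  have next_branch: "branch T t' t'' \<subset> branch T t t'"
    if "(t', t'') \<in> parcs T" "tP \<in> branch T t' t''" for t''
  proof -
    have "t'' \<noteq> t" using that(2) tP_branch opposite_branches_disjoint[OF arc] by blast
    then show ?thesis using branch_psubset[OF arc that(1)] by blast
  qed
  have Qt': "\<not> QV \<subseteq> V t'"
  proof
    assume "QV \<subseteq> V t'"
    then obtain t'' where t'': "R t' t''" using ex_R verts by blast
    then have "branch T t' t'' \<subset> branch T t t'" using next_branch by (simp add: R_def)
    moreover have "finite (branch T t t')"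
      by (rule finite_subset[OF branch_subset]) (use pair_finite_verts in blast)
    ultimately have "card (branch T t' t'') < card (branch T t t')"
      by (intro psubset_card_mono)
    then show False using min[OF t''] by linarith
  qed
  \<comment> \<open>If a vertex of $P_0$ were missing from \<open>V t'\<close>, a link from it to
    some $y_k$ would avoid \<open>V t'\<close>; its ends lie in \<open>V tP\<close> and
    \<open>V t\<close>, so \<open>t\<close> would lie beyond \<open>t'\<close>.\<close>
  have Pt': "P0 \<subseteq> V t'"
  proof (rule ccontr)
    assume no: "\<not> P0 \<subseteq> V t'"
    then obtain j where j: "1 \<le> j" "j \<le> 2 * n" "Px 0 j \<notin> V t'"
      unfolding P0_def image_subset_iff by auto
    have "tP \<noteq> t'" using no tP(2) by blast
    then obtain t'' where t'': "(t', t'') \<in> parcs T" "tP \<in> branch T t' t''"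
      by (rule ex_branch[OF tP(1) verts(2)])
    obtain k where k: "1 \<le> k" "k \<le> 4 * n" "Qy k \<notin> V t'"
      "\<forall>i j. \<not> V t' \<subseteq> Link i j k ` {1..<link_length n j k}"
      by (rule ex_good_k[OF conn[OF verts(2)] Qt'])
    let ?L = "link_vertex 0 j k ` {0..link_length n j k}"
    have L: "connected_set G ?L" using j k by (intro connected_link) (simp_all add: link_triple_def)
    have avoid: "?L \<inter> V t' = {}"
      using link_avoids[OF conn[OF verts(2)] j(3) k(3)] k(4) by blast
    have "Px 0 j \<in> V tP" using tP(2) j by (auto simp: P0_def)
    moreover have "Qy k \<in> V t" using Qt k by (auto simp: QV_def)
    ultimately have "t \<in> branch T t' t''"
      using connected_in_branch[OF t''(1) L _ Px_Qy_in_link(1) _ t''(2) Px_Qy_in_link(2) _ verts(1)]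
        avoid by blast
    then have "t \<in> branch T t t'" using next_branch[OF t''] by blast
    then show False using branch_subset by blast
  qed
  obtain j k where jk: "link_triple 0 j k" "Px 0 j \<notin> V t" "Qy k \<notin> V t'"
    "\<forall>l. Link 0 j k l \<notin> V t \<inter> V t'"
    using adjacent_parts_too_large[OF small[OF verts(1)] Qt small[OF verts(2)] Qt' Pt'] by blast
  let ?L = "link_vertex 0 j k ` {0..link_length n j k}"
  \<comment> \<open>The link joins \<open>V t'\<close> to \<open>V t\<close> while avoiding their
    intersection, which would put \<open>t\<close> into the branch of \<open>t'\<close>.\<close>
  have "?L \<inter> (V t \<inter> V t') = {}"
  proof (rule ccontr)
    assume "?L \<inter> (V t \<inter> V t') \<noteq> {}"
    then obtain v where "v \<in> ?L" "v \<in> V t \<inter> V t'" by blast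
    then show False using in_link_cases[of v 0 j k] jk(2-4) by auto
  qed
  moreover have "Px 0 j \<in> V t'" "Qy k \<in> V t"
    using Pt' Qt jk(1) by (auto simp: P0_def QV_def link_triple_def)
  ultimately have "t \<in> branch T t t'"
    using connected_in_branch[OF arc connected_link[OF jk(1)] _ Px_Qy_in_link(1) _ head_in_branch[OF arc]
        Px_Qy_in_link(2) _ verts(1)] by blast
  then show False using branch_subset by blast
qed

lemma connected_tree_width_ge: "enat (6 * n) \<le> connected_tree_width G"
  unfolding connected_tree_width_def
proof (rule INF_greatest, clarify)
  fix T :: "nat pair_pre_digraph" and V
  assume decomp: "connected_tree_decomposition G T V"
  have "pair_graph T"
    using decomp by (simp add: connected_tree_decomposition_def tree_decomposition_def undirected_tree_def)
  then have fin: "finite (pverts T)"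
    by (simp add: pair_graph_def pair_digraph_def pair_fin_digraph_def pair_fin_digraph_axioms_def)
  have "6 * n \<le> width T V"
  proof (rule ccontr)
    assume "\<not> 6 * n \<le> width T V"
    then have less: "width T V < 6 * n" by simp
    have "card (V t) \<le> 6 * n" if "t \<in> pverts T" for t
    proof -
      have "card (V t) - 1 \<le> width T V"
        unfolding width_def using fin that by (intro Max_ge) auto
      then show ?thesis using less by simp
    qed
    then show False using no_small_decomposition[OF decomp] by blast
  qed
  then show "enat (6 * n) \<le> enat (width T V)" by simp
qed

end

theorem mainTheorem4:
  fixes n :: nat and a b :: vertex and G :: "vertex pair_pre_digraph"
  assumes "n \<ge> 4"
    and "a \<in> pverts (C_graph n)" and "b \<in> pverts (C_graph n)"
    and "graph_dist (C_graph n) a b = ereal (real (8 * n + 1))"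
    and "G = gap_graph n a b"
  shows "(\<forall>B. bramble G B \<longrightarrow> connected_order G B \<le> enat (5 * n + 3)) \<and>
         connected_tree_width G \<ge> enat (6 * n) \<and>
         (\<forall>B. bramble G B \<longrightarrow> connected_order G B < connected_tree_width G)"
proof -
  obtain \<alpha> where \<alpha>: "a = Cyc \<alpha>" "\<alpha> < 16 * n + 2"
    using assms(2) by (auto simp: C_graph_def cycle_list_def)
  interpret gap n \<alpha> by unfold_locales (rule assms(1))
  have a: "a = cyc 0" using \<alpha> by (simp add: cyc_def N_def)
  have b: "b = cyc half"
    using antipodal[OF assms(3)] assms(4) unfolding a half_def by simp
  have G: "G = gap_graph n (cyc 0) (cyc half)" using assms(5) a b by simp
  have order: "connected_order G B \<le> enat (5 * n + 3)" if "bramble G B" for B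
    using that unfolding G by (rule connected_order_bramble_le)
  have width: "enat (6 * n) \<le> connected_tree_width G"
    unfolding G by (rule connected_tree_width_ge)
  \<comment> \<open>The strict gap between the two bounds comes from
    \<open>n \<ge> 4\<close>.\<close>
  have "enat (5 * n + 3) < enat (6 * n)" using assms(1) by simp
  then have "connected_order G B < connected_tree_width G" if "bramble G B" for B
    using order[OF that] width by (meson le_less_trans less_le_trans)
  then show ?thesis using order width by blast
qed

end
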